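(* Let $G$ be a simple graph with signless Laplacian matrix $Q$. Then $$\frac{\det(Q)}{4}\geq oc(G),$$ where $oc(G)$ is the number of odd cycles in $G$, and equality holds if and only if $G$ is a bipartite graph or an odd-unicyclic graph.
   Context: Graphs are finite and simple. The signless Laplacian matrix of $G$ is $Q=D+A$, where $D$ is the diagonal matrix of vertex degrees and $A$ is the $0/1$ adjacency matrix of $G$. An odd cycle of $G$ is a cycle of odd length that is a subgraph of $G$ (cycles are counted as subgraphs). An odd-unicyclic graph is a connected graph containing exactly one cycle, that cycle having odd length.
   Formalization: Assumes in addition that G is bipartite or has no bipartite connected component (and has a vertex); otherwise the claim is false: for a triangle plus an isolated vertex det(Q)=0 but oc(G)=1, and the inequality fails for every excluded graph with vertices. *)

theory Defs
  imports "HOL-Analysis.Analysis"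
begin

type_synonym 'v graph = "'v set \<times> 'v set set"

abbreviation verts :: "'v graph \<Rightarrow> 'v set" where "verts \<equiv> fst"
abbreviation edges :: "'v graph \<Rightarrow> 'v set set" where "edges \<equiv> snd"

definition simple_graph :: "'v graph \<Rightarrow> bool" where
  "simple_graph G \<longleftrightarrow> finite (verts G) \<and> (\<forall>e\<in>edges G. e \<subseteq> verts G \<and> card e = 2)"

definition subgraph :: "'v graph \<Rightarrow> 'v graph \<Rightarrow> bool" where
  "subgraph H G \<longleftrightarrow> simple_graph H \<and> verts H \<subseteq> verts G \<and> edges H \<subseteq> edges G"

(* The graph with no vertices is not connected. *)
definition connected_graph :: "'v graph \<Rightarrow> bool" where
  "connected_graph G \<longleftrightarrow> verts G \<noteq> {} \<and>
     (\<forall>u\<in>verts G. \<forall>v\<in>verts G. (u, v) \<in> {(x, y). {x, y} \<in> edges G}\<^sup>*)"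

definition component :: "'v graph \<Rightarrow> 'v graph \<Rightarrow> bool" where
  "component C G \<longleftrightarrow> subgraph C G \<and> connected_graph C \<and>
     (\<forall>H. subgraph H G \<and> connected_graph H \<and> subgraph C H \<longrightarrow> H = C)"

definition bipartite :: "'v graph \<Rightarrow> bool" where
  "bipartite G \<longleftrightarrow> (\<exists>X Y. X \<union> Y = verts G \<and> X \<inter> Y = {} \<and>
     (\<forall>e\<in>edges G. \<exists>x\<in>X. \<exists>y\<in>Y. e = {x, y}))"

(* A cycle is a graph, not a closed walk: different starting points and
   orientations of the list vs give the same cycle. *)
definition is_cycle :: "'v graph \<Rightarrow> bool" where
  "is_cycle C \<longleftrightarrow> (\<exists>vs. distinct vs \<and> length vs \<ge> 3 \<and> verts C = set vs \<and>
     edges C = {{vs ! i, vs ! (Suc i mod length vs)} | i. i < length vs})"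

definition cycles :: "'v graph \<Rightarrow> 'v graph set" where
  "cycles G = {C. is_cycle C \<and> subgraph C G}"

definition odd_cycles :: "'v graph \<Rightarrow> 'v graph set" where
  "odd_cycles G = {C \<in> cycles G. odd (card (edges C))}"

definition oc :: "'v graph \<Rightarrow> nat" where
  "oc G = card (odd_cycles G)"

definition odd_unicyclic :: "'v graph \<Rightarrow> bool" where
  "odd_unicyclic G \<longleftrightarrow> connected_graph G \<and>
     (\<exists>C. cycles G = {C} \<and> odd (card (edges C)))"

definition degree :: "'v graph \<Rightarrow> 'v \<Rightarrow> nat" where
  "degree G v = card {e \<in> edges G. v \<in> e}"

(* Rows and columns are indexed by the whole type 'v, so these are the matrices
   of G when verts G = UNIV. *)
definition degree_matrix :: "'v::finite graph \<Rightarrow> real^'v^'v" where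
  "degree_matrix G = (\<chi> i j. if i = j then real (degree G i) else 0)"

definition adjacency_matrix :: "'v::finite graph \<Rightarrow> real^'v^'v" where
  "adjacency_matrix G = (\<chi> i j. if {i, j} \<in> edges G then 1 else 0)"

definition signless_laplacian :: "'v::finite graph \<Rightarrow> real^'v^'v" where
  "signless_laplacian G = degree_matrix G + adjacency_matrix G"

end

theory Submission
  imports Defs
begin

text \<open>
Row \<open>i\<close> of the signless Laplacian is the sum of \<open>e\<^sub>i + e\<^sub>j\<close> over the neighbours \<open>j\<close> of \<open>i\<close>.
Multilinearity expands the determinant into a sum over all maps \<open>h\<close> that send every vertex to one
of its neighbours, the summand being the determinant of the matrix with rows \<open>e\<^sub>i + e\<^bsub>h i\<^esub>\<close>. This
determinant vanishes if \<open>h\<close> has a periodic orbit of even length. If all periodic orbits are odd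
(such an \<open>h\<close> is called an odd map), it is the number of sets \<open>X\<close> with \<open>h ` X = X\<close>, that is, \<open>2\<close> to
the number of periodic orbits. So the determinant counts pairs of an odd map and an invariant set
(\<open>det_signless_laplacian_eq_sum_invariant_sets\<close>). The periodic orbits of odd maps are odd cycles of
the graph, and the theorem becomes a matter of counting odd maps.

A bipartite graph has neither odd maps nor odd cycles. If no component is bipartite, the matrix is
nonsingular (\<open>singular_imp_bipartite_component\<close>), so there is at least one odd map.

In a connected graph, an odd cycle with either of its directions extends to an odd map under which
every vertex flows into that cycle. This gives two maps for each odd cycle, each with at least two
invariant sets, and the cycle can be read off from the map; hence the determinant is at least four
times the number of odd cycles. For the case of equality take a map \<open>h\<close> that flows into a shortest
odd cycle \<open>C\<close>. An edge that \<open>h\<close> does not use gives a third map for \<open>C\<close>, since a chord of \<open>C\<close> would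
create a shorter odd cycle (\<open>third_cycle_map\<close>). So equality forces every edge to have the form
\<open>{x, h x}\<close>, and then \<open>C\<close> is the only cycle. Conversely, if an odd cycle \<open>C\<close> is the only cycle, then
all edges have this form for every odd map \<open>h\<close>, two odd maps can only differ in the direction on \<open>C\<close>
(\<open>card_cycle_maps_unicyclic\<close>), and the determinant is at most \<open>4\<close>.

In a disconnected graph without bipartite components every odd map has at least four invariant
sets, and modifying a fixed odd map in one component at a time produces more odd maps than there are
odd cycles (\<open>oc_bound_disconnected\<close>). The inequality is therefore strict.
\<close>

section \<open>Maps sending every vertex to a neighbour\<close>

definition functional_matrix :: "('v::finite \<Rightarrow> 'v) \<Rightarrow> real^'v^'v" where
  "functional_matrix h = (\<chi> i. axis i 1 + axis (h i) 1)"

definition invariant_sets :: "('v \<Rightarrow> 'v) \<Rightarrow> 'v set set" where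
  "invariant_sets h = {X. h ` X = X}"

text \<open>The least period of a point divides all its periods, so a point has an odd period precisely if its
cycle has odd length. The condition therefore says that all cycles of \<^term>\<open>h\<close> are odd.\<close>

definition odd_periodic :: "('v \<Rightarrow> 'v) \<Rightarrow> bool" where
  "odd_periodic h \<longleftrightarrow>
     (\<forall>x n. n > 0 \<and> (h ^^ n) x = x \<longrightarrow> (\<exists>m. odd m \<and> (h ^^ m) x = x))"

definition neighbour_maps :: "'v graph \<Rightarrow> ('v \<Rightarrow> 'v) set" where
  "neighbour_maps G = {h. \<forall>i. {i, h i} \<in> edges G}"

definition odd_maps :: "'v graph \<Rightarrow> ('v \<Rightarrow> 'v) set" where
  "odd_maps G = {h \<in> neighbour_maps G. odd_periodic h}"

lemma edge_endpoints_distinct: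
  assumes "simple_graph G" "{u, v} \<in> edges G"
  shows "u \<noteq> v"
  using assms unfolding simple_graph_def by fastforce

lemma funpow_fixed_mult:
  assumes "(f ^^ m) x = x"
  shows "(f ^^ (m * k)) x = x"
  by (induction k) (simp_all add: funpow_add assms)

lemma funpow_in_closed:
  assumes "f ` S \<subseteq> S" "x \<in> S"
  shows "(f ^^ n) x \<in> S"
  by (induction n) (use assms in auto)

lemma funpow_agree_on_closed:
  assumes "f ` S \<subseteq> S" "\<And>y. y \<in> S \<Longrightarrow> g y = f y" "x \<in> S"
  shows "(g ^^ n) x = (f ^^ n) x"
  by (induction n) (use assms funpow_in_closed[OF assms(1,3)] in auto)

lemma invariant_set_periodic:
  assumes "finite X" "h ` X = X" "x \<in> X"
  obtains n where "n > 0" "(h ^^ n) x = x"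
proof -
  have inj: "inj_on h X"
    using assms by (simp add: eq_card_imp_inj_on)
  have mem: "(h ^^ n) x \<in> X" for n
    using funpow_in_closed[of h X] assms by auto
  have "\<not> inj (\<lambda>n. (h ^^ n) x)"
    using mem assms(1) by (metis finite_subset image_subset_iff finite_imageD infinite_UNIV_nat)
  then obtain i j where ij: "i < j" "(h ^^ i) x = (h ^^ j) x"
    unfolding inj_on_def by (metis nat_neq_iff)
  have "(h ^^ i) a = (h ^^ i) b \<Longrightarrow> a \<in> X \<Longrightarrow> b \<in> X \<Longrightarrow> a = b" for i a b
    by (induction i arbitrary: a b)
      (use inj funpow_in_closed[of h X] assms(2) in \<open>auto simp: inj_on_def\<close>)
  moreover have "(h ^^ i) ((h ^^ (j - i)) x) = (h ^^ i) x"
    using ij by (simp add: funpow_add[symmetric, THEN fun_cong, unfolded o_def])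
  ultimately have "(h ^^ (j - i)) x = x"
    using mem assms(3) by blast
  with ij show ?thesis
    by (intro that[of "j - i"]) auto
qed

text \<open>A minimal nonempty closed subset is mapped onto itself.\<close>

lemma closed_contains_invariant_set:
  assumes "finite S" "S \<noteq> {}" "h ` S \<subseteq> S"
  obtains X where "X \<subseteq> S" "X \<noteq> {}" "h ` X = X"
proof -
  let ?P = "\<lambda>X. X \<subseteq> S \<and> X \<noteq> {} \<and> h ` X \<subseteq> X"
  obtain X where X: "?P X" and min: "\<And>Y. ?P Y \<Longrightarrow> card X \<le> card Y"
    using ex_has_least_nat[of ?P S card] assms by blast
  have "?P (h ` X)"
    using X assms by auto
  then have "card X \<le> card (h ` X)"
    by (rule min)
  then have "h ` X = X"
    using X assms(1) by (meson card_seteq finite_subset)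
  with X that show ?thesis
    by blast
qed

section \<open>The determinant as a sum over odd maps\<close>

lemma degree_eq_card_neighbours:
  fixes G :: "'v::finite graph"
  assumes "simple_graph G"
  shows "degree G i = card {j. {i, j} \<in> edges G}"
proof -
  have "{e \<in> edges G. i \<in> e} = (\<lambda>j. {i, j}) ` {j. {i, j} \<in> edges G}"
  proof (intro equalityI subsetI)
    fix e assume e: "e \<in> {e \<in> edges G. i \<in> e}"
    then obtain a b where "e = {a, b}"
      using assms unfolding simple_graph_def by (metis (lifting) card_2_iff mem_Collect_eq)
    with e show "e \<in> (\<lambda>j. {i, j}) ` {j. {i, j} \<in> edges G}"
      by (auto simp: insert_commute)
  qed auto
  moreover have "inj_on (\<lambda>j. {i, j}) {j. {i, j} \<in> edges G}"
    by (auto simp: inj_on_def doubleton_eq_iff)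
  ultimately show ?thesis
    by (simp add: degree_def card_image)
qed

text \<open>Row \<^term>\<open>i\<close> of the signless Laplacian is the sum of the vectors
\<^term>\<open>axis i 1 + axis j 1\<close> over the neighbours \<^term>\<open>j\<close> of \<^term>\<open>i\<close>. Multilinearity of the
determinant in the rows turns the choice of one neighbour per row into a map.\<close>

lemma det_signless_laplacian_eq_sum_functional:
  fixes G :: "'v::finite graph"
  assumes "simple_graph G"
  shows "det (signless_laplacian G) = (\<Sum>h\<in>neighbour_maps G. det (functional_matrix h))"
proof -
  define a :: "'v \<Rightarrow> 'v \<Rightarrow> real^'v" where
    "a i j = (if {i, j} \<in> edges G then axis i 1 + axis j 1 else 0)" for i j
  have entry: "signless_laplacian G $ i $ k = sum (a i) UNIV $ k" for i k
  proof -
    have "sum (a i) UNIV $ k = (\<Sum>j\<in>{j. {i, j} \<in> edges G}. axis i 1 $ k + axis j 1 $ k)"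
      by (simp add: a_def if_distrib[of "\<lambda>v. v $ k"] sum.If_cases cong: if_cong)
    also have "\<dots> = (if k = i then real (degree G i) else 0)
        + (\<Sum>j\<in>{j. {i, j} \<in> edges G}. if j = k then 1 else 0)"
      by (simp add: sum.distrib axis_def degree_eq_card_neighbours[OF assms] eq_commute)
    also have "\<dots> = signless_laplacian G $ i $ k"
      by (simp add: signless_laplacian_def degree_matrix_def adjacency_matrix_def)
    finally show ?thesis ..
  qed
  have "signless_laplacian G = (\<chi> i. sum (a i) UNIV)"
    by (simp add: vec_eq_iff entry)
  then have "det (signless_laplacian G) = (\<Sum>h\<in>UNIV. det (\<chi> i. a i (h i)))"
    using det_linear_rows_sum[of UNIV a] by simp
  also have "\<dots> = (\<Sum>h\<in>neighbour_maps G. det (\<chi> i. a i (h i)))"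
  proof (rule sum.mono_neutral_right)
    show "\<forall>h\<in>UNIV - neighbour_maps G. det (\<chi> i. a i (h i)) = 0"
    proof
      fix h assume "h \<in> UNIV - neighbour_maps G"
      then obtain i where "{i, h i} \<notin> edges G"
        by (auto simp: neighbour_maps_def)
      then have "row i (\<chi> i. a i (h i)) = 0"
        by (simp add: a_def row_def vec_eq_iff)
      then show "det (\<chi> i. a i (h i)) = 0"
        by (rule det_zero_row)
    qed
  qed auto
  also have "\<dots> = (\<Sum>h\<in>neighbour_maps G. det (functional_matrix h))"
    by (intro sum.cong) (auto simp: a_def functional_matrix_def neighbour_maps_def)
  finally show ?thesis .
qed

text \<open>Along a closed orbit of even length the rows of the matrix, taken with alternating signs, telescope
to zero. The orbit may run around its cycle several times: since \<^term>\<open>x\<close> has only even periods,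
all visits to \<^term>\<open>x\<close> carry the sign \<open>+\<close>, so the combination is nontrivial.\<close>

lemma det_functional_matrix_no_odd_period:
  fixes h :: "'v::finite \<Rightarrow> 'v"
  assumes n: "n > 0" "(h ^^ n) x = x" and no_odd: "\<And>m. odd m \<Longrightarrow> (h ^^ m) x \<noteq> x"
  shows "det (functional_matrix h) = 0"
proof -
  define y :: "real^'v" where
    "y = (\<Sum>k<n. (-1) ^ k *\<^sub>R axis ((h ^^ k) x) 1)"
  have "even n"
    using n no_odd by blast
  \<comment> \<open>Consecutive rows share the vector of the vertex between them.\<close>
  have telescope: "(\<Sum>k<N. (-1) ^ k *\<^sub>R (axis ((h ^^ k) x) 1 + axis ((h ^^ Suc k) x) 1))
      = axis x 1 - (-1) ^ N *\<^sub>R (axis ((h ^^ N) x) 1 :: real^'v)" for N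
    by (induction N) (simp_all add: algebra_simps)
  have row: "axis i 1 v* functional_matrix h = axis i 1 + (axis (h i) 1 :: real^'v)" for i
    by (simp add: vec_eq_iff vector_matrix_mult_def functional_matrix_def axis_def
        if_distrib[of "\<lambda>c. c * _"] if_distrib[of "\<lambda>c. _ * c"] cong: if_cong)
  have lin: "linear (\<lambda>y. y v* functional_matrix h)"
    by (simp add: linear_iff vector_matrix_left_distrib scaleR_vector_matrix_assoc)
  have "y v* functional_matrix h
      = (\<Sum>k<n. (-1) ^ k *\<^sub>R (axis ((h ^^ k) x) 1 v* functional_matrix h))"
    unfolding y_def by (simp add: linear_sum[OF lin] linear_cmul[OF lin])
  also have "\<dots> = (\<Sum>k<n. (-1) ^ k *\<^sub>R (axis ((h ^^ k) x) 1 + axis ((h ^^ Suc k) x) 1))"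
    by (simp add: row)
  also have "\<dots> = 0"
    using telescope[of n] \<open>even n\<close> n by simp
  finally have "transpose (functional_matrix h) *v y = 0"
    by simp
  moreover have "y \<noteq> 0"
  proof -
    have "(axis x 1 $ x :: real) \<le> (\<Sum>k<n. ((-1) ^ k *\<^sub>R axis ((h ^^ k) x) 1) $ x)"
    proof -
      have "0 \<le> ((-1) ^ k *\<^sub>R axis ((h ^^ k) x) 1 :: real^'v) $ x" for k
        using no_odd[of k] by (cases "even k") (auto simp: axis_def)
      then show ?thesis
        using member_le_sum[of 0 "{..<n}" "\<lambda>k. ((-1) ^ k *\<^sub>R axis ((h ^^ k) x) 1 :: real^'v) $ x"] n(1)
        by simp
    qed
    then have "1 \<le> y $ x"
      by (simp add: y_def sum_component axis_def)
    then show ?thesis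
      by auto
  qed
  ultimately have "\<not> invertible (transpose (functional_matrix h))"
    using matrix_left_invertible_ker invertible_left_inverse by blast
  then show ?thesis
    by (simp add: invertible_det_nz)
qed

lemma sign_eq_1_if_odd_order:
  fixes p :: "'v::finite \<Rightarrow> 'v"
  assumes "p permutes UNIV" "odd m" "p ^^ m = id"
  shows "sign p = 1"
proof -
  have "p ^^ n permutes UNIV" for n
    by (induction n)
      (simp_all only: funpow.simps permutes_id permutes_compose[OF _ assms(1)])
  then have perm: "permutation (p ^^ n)" for n
    by (meson finite permutation_permutes)
  have "sign (p ^^ n) = sign p ^ n" for n
  proof (induction n)
    case (Suc n)
    then show ?case
      using sign_compose[OF perm[of 1] perm[of n]] by (simp add: o_def)
  qed simp
  then have "sign p ^ m = 1"
    using assms(3) by (metis sign_id)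
  then show ?thesis
    using assms(2) by (cases p rule: sign_cases) simp_all
qed

text \<open>A permutation contributes to the Leibniz expansion only if it moves every point either to itself or
to its image under \<^term>\<open>h\<close>. Such a permutation is \<^term>\<open>h\<close> on an invariant set and the identity
elsewhere; its cycles are cycles of \<^term>\<open>h\<close>, hence of odd length, so all signs are \<open>+\<close>.\<close>

lemma det_functional_matrix_odd_periodic:
  fixes h :: "'v::finite \<Rightarrow> 'v"
  assumes nofix: "\<And>i. h i \<noteq> i" and h: "odd_periodic h"
  shows "det (functional_matrix h) = real (card (invariant_sets h))"
proof -
  define P where "P = {p. p permutes UNIV \<and> (\<forall>i. p i = i \<or> p i = h i)}"
  have prod: "(\<Prod>i\<in>UNIV. functional_matrix h $ i $ p i)
      = (if \<forall>i. p i = i \<or> p i = h i then 1 else 0)" for p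
  proof -
    have "functional_matrix h $ i $ p i = (if p i = i \<or> p i = h i then 1 else 0)" for i
      using nofix[of i] by (auto simp: functional_matrix_def axis_def)
    then show ?thesis
      by (auto intro: prod.neutral)
  qed
  have moved_invariant: "h ` {i. p i = h i} = {i. p i = h i}" if "p \<in> P" for p
  proof -
    have p: "inj p" "\<And>i. p i = i \<or> p i = h i"
      using that by (auto simp: P_def permutes_inj)
    have "p ` {i. p i = h i} \<subseteq> {i. p i = h i}"
      using p nofix by (smt (verit) image_subset_iff injD mem_Collect_eq)
    then have "p ` {i. p i = h i} = {i. p i = h i}"
      using p(1) by (intro endo_inj_surj) (auto intro: inj_on_subset)
    moreover have "p ` {i. p i = h i} = h ` {i. p i = h i}"
      by auto
    ultimately show ?thesis
      by simp
  qed
  have sign: "sign p = 1" if p: "p \<in> P" for p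
  proof -
    let ?X = "{i. p i = h i}"
    have period: "\<exists>m. odd m \<and> (p ^^ m) x = x" for x
    proof (cases "p x = x")
      case True
      then show ?thesis
        by (intro exI[of _ 1]) simp
    next
      case False
      then have x: "x \<in> ?X"
        using p by (auto simp: P_def)
      obtain n where "n > 0" "(h ^^ n) x = x"
        using invariant_set_periodic[OF _ moved_invariant[OF p] x] by auto
      then obtain m where m: "odd m" "(h ^^ m) x = x"
        using h unfolding odd_periodic_def by blast
      have "(p ^^ m) x = (h ^^ m) x"
        using moved_invariant[OF p] x by (intro funpow_agree_on_closed[of h ?X]) auto
      with m show ?thesis
        by auto
    qed
    then obtain m where m: "\<And>x. odd (m x)" "\<And>x. (p ^^ m x) x = x"
      by metis
    \<comment> \<open>A common odd period of all points shows that the permutation has odd order, hence is even.\<close>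
    let ?M = "\<Prod>x\<in>UNIV. m x"
    have "(p ^^ ?M) x = x" for x
    proof -
      have "m x dvd ?M"
        by (simp add: dvd_prodI)
      then show ?thesis
        using funpow_fixed_mult[OF m(2)[of x]] by (auto elim: dvdE)
    qed
    moreover have "odd ?M"
      using m(1) by (simp add: even_prod_iff)
    ultimately show ?thesis
      using p sign_eq_1_if_odd_order[of p ?M] by (auto simp: P_def fun_eq_iff)
  qed
  have bij: "bij_betw (\<lambda>p. {i. p i = h i}) P (invariant_sets h)"
  proof (rule bij_betw_byWitness[where f' = "\<lambda>X i. if i \<in> X then h i else i"])
    show "\<forall>p\<in>P. (\<lambda>i. if i \<in> {i. p i = h i} then h i else i) = p"
    proof (intro ballI ext)
      fix p i assume "p \<in> P"
      then have "p i = i \<or> p i = h i"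
        by (simp add: P_def)
      then show "(if i \<in> {i. p i = h i} then h i else i) = p i"
        by auto
    qed
    show "\<forall>X\<in>invariant_sets h. {i. (if i \<in> X then h i else i) = h i} = X"
      using nofix by (auto split: if_splits simp: eq_commute[of _ "h _"])
    show "(\<lambda>p. {i. p i = h i}) ` P \<subseteq> invariant_sets h"
      using moved_invariant by (auto simp: invariant_sets_def)
    show "(\<lambda>X i. if i \<in> X then h i else i) ` invariant_sets h \<subseteq> P"
    proof clarify
      fix X assume "X \<in> invariant_sets h"
      then have X: "h ` X = X"
        by (simp add: invariant_sets_def)
      then have "(\<lambda>i. if i \<in> X then h i else i) ` UNIV = UNIV"
        by (auto simp: image_iff)
      then have "bij (\<lambda>i. if i \<in> X then h i else i)"
        by (simp add: finite_UNIV_surj_inj bij_def)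
      then show "(\<lambda>i. if i \<in> X then h i else i) \<in> P"
        by (auto simp: P_def intro: bij_imp_permutes)
    qed
  qed
  have "det (functional_matrix h)
      = (\<Sum>p\<in>{p. p permutes UNIV}. if \<forall>i. p i = i \<or> p i = h i then of_int (sign p) else 0)"
    unfolding det_def prod by (intro sum.cong) auto
  also have "\<dots> = (\<Sum>p\<in>P. of_int (sign p))"
    by (simp add: P_def sum.If_cases Int_def)
  also have "\<dots> = real (card P)"
    by (simp add: sign)
  also have "card P = card (invariant_sets h)"
    using bij by (rule bij_betw_same_card)
  finally show ?thesis .
qed

lemma det_signless_laplacian_eq_sum_invariant_sets:
  fixes G :: "'v::finite graph"
  assumes "simple_graph G"
  shows "det (signless_laplacian G) = real (\<Sum>h\<in>odd_maps G. card (invariant_sets h))"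
proof -
  have "det (signless_laplacian G) = (\<Sum>h\<in>neighbour_maps G. det (functional_matrix h))"
    by (rule det_signless_laplacian_eq_sum_functional[OF assms])
  also have "\<dots> = (\<Sum>h\<in>odd_maps G. det (functional_matrix h))"
  proof (rule sum.mono_neutral_right)
    show "\<forall>h\<in>neighbour_maps G - odd_maps G. det (functional_matrix h) = 0"
    proof
      fix h assume "h \<in> neighbour_maps G - odd_maps G"
      then obtain x n where "n > 0" "(h ^^ n) x = x" "\<And>m. odd m \<Longrightarrow> (h ^^ m) x \<noteq> x"
        unfolding odd_maps_def odd_periodic_def by blast
      then show "det (functional_matrix h) = 0"
        by (rule det_functional_matrix_no_odd_period)
    qed
  qed (auto simp: odd_maps_def)
  also have "\<dots> = (\<Sum>h\<in>odd_maps G. real (card (invariant_sets h)))"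
  proof (intro sum.cong refl det_functional_matrix_odd_periodic)
    fix h i assume "h \<in> odd_maps G"
    then have "{i, h i} \<in> edges G"
      by (simp add: odd_maps_def neighbour_maps_def)
    then show "h i \<noteq> i"
      using edge_endpoints_distinct[OF assms] by metis
  qed (simp add: odd_maps_def)
  finally show ?thesis
    by simp
qed

section \<open>Cycles of a graph as orbits of a map\<close>

text \<open>A cycle together with a direction in which to run through it: \<^term>\<open>f\<close> sends each vertex of
\<^term>\<open>C\<close> to the next one. Excluding \<^term>\<open>f (f x) = x\<close> rules out single vertices and single
edges. The values of \<^term>\<open>f\<close> off \<^term>\<open>C\<close> are free, so one map can trace several cycles.\<close>

definition traces :: "('v \<Rightarrow> 'v) \<Rightarrow> 'v graph \<Rightarrow> bool" where
  "traces f C \<longleftrightarrow> verts C \<noteq> {} \<and> f ` verts C = verts C \<and>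
     (\<forall>x\<in>verts C. \<forall>y\<in>verts C. \<exists>n. (f ^^ n) x = y) \<and>
     (\<forall>x\<in>verts C. f (f x) \<noteq> x) \<and>
     edges C = (\<lambda>x. {x, f x}) ` verts C"

definition orbit_graph :: "('v \<Rightarrow> 'v) \<Rightarrow> 'v \<Rightarrow> 'v graph" where
  "orbit_graph f x =
     (range (\<lambda>n. (f ^^ n) x), range (\<lambda>n. {(f ^^ n) x, (f ^^ Suc n) x}))"

lemma least_period:
  assumes "n > 0" "(f ^^ n) x = x"
  obtains L where "L > 0" "\<And>k. (f ^^ k) x = x \<longleftrightarrow> L dvd k"
    "inj_on (\<lambda>k. (f ^^ k) x) {..<L}"
    "range (\<lambda>k. (f ^^ k) x) = (\<lambda>k. (f ^^ k) x) ` {..<L}"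
proof -
  define L where "L = (LEAST k. k > 0 \<and> (f ^^ k) x = x)"
  have L: "L > 0" "(f ^^ L) x = x"
    using LeastI[of "\<lambda>k. k > 0 \<and> (f ^^ k) x = x" n] assms by (auto simp: L_def)
  have least: "L \<le> k" if "k > 0" "(f ^^ k) x = x" for k
    using that unfolding L_def by (intro Least_le) auto
  have mod: "(f ^^ (k mod L)) x = (f ^^ k) x" for k
    by (rule funpow_mod_eq[OF L(2)])
  have dvd: "(f ^^ k) x = x \<longleftrightarrow> L dvd k" for k
  proof
    assume "(f ^^ k) x = x"
    then have "\<not> k mod L > 0"
      using least[of "k mod L"] mod[of k] L(1) by (metis mod_less_divisor not_le)
    then show "L dvd k"
      by auto
  next
    assume "L dvd k"
    then show "(f ^^ k) x = x"
      using mod[of k] by simp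
  qed
  have "(f ^^ i) x \<noteq> (f ^^ j) x" if "i < j" "j < L" for i j
  proof
    assume "(f ^^ i) x = (f ^^ j) x"
    then have "(f ^^ (L - j + i)) x = (f ^^ (L - j + j)) x"
      by (simp only: funpow_add o_def)
    then have "(f ^^ (L - j + i)) x = x"
      using that L by simp
    then have "L \<le> L - j + i"
      using that by (intro least) auto
    with that show False
      by simp
  qed
  then have "inj_on (\<lambda>k. (f ^^ k) x) {..<L}"
    unfolding inj_on_def by (metis lessThan_iff nat_neq_iff)
  moreover have "range (\<lambda>k. (f ^^ k) x) = (\<lambda>k. (f ^^ k) x) ` {..<L}"
  proof -
    have "(f ^^ k) x \<in> (\<lambda>k. (f ^^ k) x) ` {..<L}" for k
      using mod[of k] L(1) by (intro image_eqI[of _ _ "k mod L"]) auto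
    then show ?thesis
      by auto
  qed
  ultimately show ?thesis
    using that L(1) dvd by blast
qed

lemma traces_cong:
  assumes "traces f C" "\<And>x. x \<in> verts C \<Longrightarrow> h x = f x"
  shows "traces h C"
proof -
  have f: "f ` verts C = verts C"
    using assms(1) by (simp add: traces_def)
  have "(h ^^ n) x = (f ^^ n) x" if "x \<in> verts C" for n x
    using f assms(2) that by (intro funpow_agree_on_closed[of f "verts C"]) auto
  moreover have "f x \<in> verts C" if "x \<in> verts C" for x
    using f that by auto
  ultimately show ?thesis
    using assms unfolding traces_def by (simp cong: image_cong_simp)
qed

lemma traces_verts_eq_orbit:
  assumes "traces f C" "x \<in> verts C"
  shows "verts C = range (\<lambda>k. (f ^^ k) x)"
proof (intro equalityI subsetI)
  fix y assume "y \<in> verts C"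
  then obtain n where "(f ^^ n) x = y"
    using assms unfolding traces_def by blast
  then show "y \<in> range (\<lambda>k. (f ^^ k) x)"
    by blast
next
  fix y assume "y \<in> range (\<lambda>k. (f ^^ k) x)"
  then show "y \<in> verts C"
    using assms funpow_in_closed[of f "verts C" x] by (auto simp: traces_def)
qed

lemma traces_period:
  assumes "finite (verts C)" "traces f C" "x \<in> verts C"
  shows "(f ^^ k) x = x \<longleftrightarrow> card (verts C) dvd k"
    and "verts C = (\<lambda>k. (f ^^ k) x) ` {..<card (verts C)}"
proof -
  have inv: "f ` verts C = verts C"
    using assms by (simp add: traces_def)
  obtain n where n: "n > 0" "(f ^^ n) x = x"
    using invariant_set_periodic[OF assms(1) inv assms(3)] .
  obtain L where L: "L > 0" "\<And>k. (f ^^ k) x = x \<longleftrightarrow> L dvd k"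
    "inj_on (\<lambda>k. (f ^^ k) x) {..<L}"
    "range (\<lambda>k. (f ^^ k) x) = (\<lambda>k. (f ^^ k) x) ` {..<L}"
    by (rule least_period[OF n]) (rule that)
  have "verts C = range (\<lambda>k. (f ^^ k) x)"
    by (rule traces_verts_eq_orbit[OF assms(2,3)])
  then have "verts C = (\<lambda>k. (f ^^ k) x) ` {..<L}"
    by (simp add: L(4))
  moreover from this have "card (verts C) = L"
    by (simp add: card_image[OF L(3)])
  ultimately show "(f ^^ k) x = x \<longleftrightarrow> card (verts C) dvd k"
    "verts C = (\<lambda>k. (f ^^ k) x) ` {..<card (verts C)}"
    using L(2) by auto
qed

lemma traces_card_edges:
  assumes "traces f C"
  shows "card (edges C) = card (verts C)"
proof -
  have "inj_on (\<lambda>x. {x, f x}) (verts C)"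
    using assms unfolding traces_def inj_on_def by (metis doubleton_eq_iff)
  then show ?thesis
    using assms by (simp add: traces_def card_image)
qed

lemma traces_imp_is_cycle:
  assumes "finite (verts C)" "traces f C"
  shows "is_cycle C"
proof -
  obtain x where x: "x \<in> verts C"
    using assms(2) by (auto simp: traces_def)
  define L where "L = card (verts C)"
  define vs where "vs = map (\<lambda>k. (f ^^ k) x) [0..<L]"
  have vs_length: "length vs = L"
    by (simp add: vs_def)
  note period = traces_period[OF assms x, folded L_def]
  have "f (f x) \<noteq> x" "L > 0"
    using assms x by (auto simp: traces_def L_def card_gt_0_iff)
  then have "\<not> L dvd 2"
    using period(1)[of 2] by (simp add: numeral_2_eq_2)
  then have "L \<ge> 3"
    using \<open>L > 0\<close> by (cases "L = 1"; cases "L = 2") auto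
  have verts: "verts C = set vs"
    using period(2) by (auto simp: vs_def)
  then have "distinct vs"
    by (intro card_distinct) (simp add: vs_def L_def)
  have edge: "{vs ! i, vs ! (Suc i mod length vs)} = {(f ^^ i) x, f ((f ^^ i) x)}" if "i < L" for i
  proof -
    have "(f ^^ L) x = x"
      using period(1) by simp
    then have "(f ^^ (Suc i mod L)) x = (f ^^ Suc i) x"
      by (rule funpow_mod_eq)
    then show ?thesis
      using that \<open>L > 0\<close> by (simp add: vs_def)
  qed
  have "edges C = (\<lambda>i. {(f ^^ i) x, f ((f ^^ i) x)}) ` {..<L}"
  proof -
    have "edges C = (\<lambda>x. {x, f x}) ` (\<lambda>k. (f ^^ k) x) ` {..<L}"
      using assms(2) by (simp add: traces_def flip: period(2))
    then show ?thesis
      by (simp add: image_image)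
  qed
  also have "\<dots> = {{vs ! i, vs ! (Suc i mod length vs)} | i. i < length vs}"
    using edge by (auto simp: Setcompr_eq_image vs_length)
  finally show ?thesis
    unfolding is_cycle_def using verts \<open>distinct vs\<close> \<open>L \<ge> 3\<close> vs_length
    by (intro exI[of _ vs]) simp
qed

lemma is_cycle_imp_traces:
  assumes "is_cycle C"
  obtains f where "traces f C"
proof -
  obtain vs where vs: "distinct vs" "length vs \<ge> 3" "verts C = set vs"
    "edges C = {{vs ! i, vs ! (Suc i mod length vs)} | i. i < length vs}"
    using assms unfolding is_cycle_def by blast
  let ?L = "length vs"
  define pos where "pos = the_inv_into {..<?L} ((!) vs)"
  have pos: "pos (vs ! i) = i" if "i < ?L" for i
    unfolding pos_def using vs(1) that
    by (intro the_inv_into_f_f) (auto simp: inj_on_def nth_eq_iff_index_eq)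
  define f where "f v = vs ! (Suc (pos v) mod ?L)" for v
  have "?L > 0"
    using vs(2) by linarith
  have f: "f (vs ! i) = vs ! (Suc i mod ?L)" if "i < ?L" for i
    using that by (simp add: f_def pos)
  have pow: "(f ^^ n) (vs ! i) = vs ! ((i + n) mod ?L)" if "i < ?L" for i n
    using that \<open>?L > 0\<close> by (induction n) (simp_all add: f mod_Suc_eq)
  have nth: "\<exists>i<?L. x = vs ! i" if "x \<in> verts C" for x
    using that vs(3) by (auto simp: in_set_conv_nth)
  have "\<exists>n. (f ^^ n) x = y" if xy: "x \<in> verts C" "y \<in> verts C" for x y
  proof -
    obtain i j where ij: "i < ?L" "x = vs ! i" "j < ?L" "y = vs ! j"
      using nth xy by blast
    have "(f ^^ (?L - i + j)) x = vs ! ((i + (?L - i + j)) mod ?L)"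
      using ij pow by blast
    also have "i + (?L - i + j) = ?L + j"
      using ij by simp
    finally show ?thesis
      using ij by auto
  qed
  moreover have closed: "f ` verts C \<subseteq> verts C"
    using nth f \<open>?L > 0\<close> vs(3) by fastforce
  moreover have "verts C \<subseteq> f ` verts C"
  proof
    fix x assume x: "x \<in> verts C"
    then obtain i where i: "i < ?L" "x = vs ! i"
      using nth by blast
    have "f ((f ^^ (?L - 1)) x) = (f ^^ ?L) x"
      using \<open>?L > 0\<close> by (cases ?L) auto
    also have "\<dots> = x"
      using i pow[of i ?L] by simp
    finally show "x \<in> f ` verts C"
      using funpow_in_closed[OF closed x] by (metis image_eqI)
  qed
  moreover have "f (f x) \<noteq> x" if x: "x \<in> verts C" for x
  proof -
    obtain i where i: "i < ?L" "x = vs ! i"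
      using nth x by blast
    have "f (f x) = vs ! ((i + 2) mod ?L)"
      using pow[of i 2] i by (simp add: numeral_2_eq_2)
    moreover have "(i + 2) mod ?L \<noteq> i" "(i + 2) mod ?L < ?L"
      using i vs(2) by (auto simp: mod_if)
    ultimately show ?thesis
      using i vs(1) nth_eq_iff_index_eq[OF vs(1)] by metis
  qed
  moreover have "edges C = (\<lambda>x. {x, f x}) ` verts C"
  proof -
    have "edges C = (\<lambda>i. {vs ! i, vs ! (Suc i mod ?L)}) ` {i. i < ?L}"
      unfolding vs(4) by blast
    also have "\<dots> = (\<lambda>i. {vs ! i, f (vs ! i)}) ` {i. i < ?L}"
      by (intro image_cong) (auto simp: f)
    also have "\<dots> = (\<lambda>x. {x, f x}) ` (\<lambda>i. vs ! i) ` {i. i < ?L}"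
      by (simp add: image_image)
    also have "(\<lambda>i. vs ! i) ` {i. i < ?L} = verts C"
      using vs(3) by (auto simp: set_conv_nth)
    finally show ?thesis .
  qed
  moreover have "verts C \<noteq> {}"
    using vs(2,3) by auto
  ultimately have "traces f C"
    unfolding traces_def by blast
  then show ?thesis
    by (rule that)
qed

lemma traces_reverse:
  assumes g: "traces g C" and inv: "\<And>x. x \<in> verts C \<Longrightarrow> h (g x) = x"
  shows "traces h C"
proof -
  let ?W = "verts C"
  have g_img: "g ` ?W = ?W"
    using g by (simp add: traces_def)
  have surj: "\<exists>z\<in>?W. x = g z" if "x \<in> ?W" for x
    using g_img that by blast
  have mem: "(g ^^ n) x \<in> ?W" if "x \<in> ?W" for n x
    using funpow_in_closed[of g ?W] g_img that by blast
  have pow: "(h ^^ n) ((g ^^ n) x) = x" if "x \<in> ?W" for n x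
    using that
  proof (induction n)
    case (Suc n)
    have "(h ^^ Suc n) ((g ^^ Suc n) x) = (h ^^ n) (h (g ((g ^^ n) x)))"
      by (simp add: funpow_swap1)
    then show ?case
      using Suc mem inv by simp
  qed simp
  have "h ` ?W = h ` g ` ?W"
    by (simp add: g_img)
  also have "\<dots> = ?W"
    using inv by (simp add: image_image cong: image_cong)
  finally have "h ` ?W = ?W" .
  moreover have "\<exists>n. (h ^^ n) x = y" if "x \<in> ?W" "y \<in> ?W" for x y
  proof -
    obtain n where "(g ^^ n) y = x"
      using g \<open>x \<in> ?W\<close> \<open>y \<in> ?W\<close> unfolding traces_def by blast
    with pow[OF \<open>y \<in> ?W\<close>, of n] show ?thesis
      by auto
  qed
  moreover have "h (h x) \<noteq> x" if x: "x \<in> ?W" for x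
  proof -
    obtain y z where yz: "z \<in> ?W" "y \<in> ?W" "y = g z" "x = g y"
      using surj x by metis
    then have "h (h x) = z"
      using inv by simp
    then show ?thesis
      using g yz unfolding traces_def by metis
  qed
  moreover have "edges C = (\<lambda>x. {x, h x}) ` ?W"
  proof -
    have "(\<lambda>x. {x, h x}) ` ?W = (\<lambda>x. {x, h x}) ` g ` ?W"
      by (simp add: g_img)
    also have "\<dots> = (\<lambda>x. {x, g x}) ` ?W"
      using inv by (simp add: image_image insert_commute cong: image_cong)
    finally show ?thesis
      using g by (simp add: traces_def)
  qed
  moreover have "?W \<noteq> {}"
    using g by (simp add: traces_def)
  ultimately show ?thesis
    unfolding traces_def by (intro conjI ballI) (assumption | metis)+
qed

text \<open>At each vertex \<^term>\<open>h\<close> uses the edge of \<^term>\<open>C\<close> ahead of it in one of the two directions. A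
backward step at one vertex forces a backward step at the next, because the cycle is longer than
two; running around the cycle makes the direction constant.\<close>

lemma forward_or_backward:
  assumes g: "traces g C"
    and either: "\<And>x. x \<in> verts C \<Longrightarrow> h x = g x \<or> h (g x) = x"
  shows "(\<forall>x\<in>verts C. h x = g x) \<or> (\<forall>x\<in>verts C. h (g x) = x)"
proof (cases "\<forall>x\<in>verts C. h x = g x")
  case False
  then obtain x where x: "x \<in> verts C" "h x \<noteq> g x"
    by blast
  have img: "g ` verts C \<subseteq> verts C" and no2: "\<And>y. y \<in> verts C \<Longrightarrow> g (g y) \<noteq> y"
    using g by (auto simp: traces_def)
  have "h (g ((g ^^ n) x)) = (g ^^ n) x" for n
  proof (induction n)
    case 0
    then show ?case
      using either x by auto
  next
    case (Suc n)
    have y: "(g ^^ n) x \<in> verts C" "(g ^^ Suc n) x \<in> verts C"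
      using funpow_in_closed[OF img x(1)] by blast+
    have "h ((g ^^ Suc n) x) \<noteq> g ((g ^^ Suc n) x)"
      using Suc no2[OF y(1)] by simp
    then show ?case
      using either[OF y(2)] by blast
  qed
  then have "h (g y) = y" if "y \<in> verts C" for y
    using g x(1) that unfolding traces_def by metis
  then show ?thesis
    by blast
qed auto

lemma traces_if_follows_edges:
  assumes "traces g C" "\<And>x. x \<in> verts C \<Longrightarrow> h x = g x \<or> h (g x) = x"
  shows "traces h C"
  using forward_or_backward[OF assms] traces_cong[OF assms(1)] traces_reverse[OF assms(1)] by metis

lemma traces_reverse_exists:
  assumes "finite (verts C)" "traces g C"
  obtains h where "traces h C" "\<And>x. x \<in> verts C \<Longrightarrow> h x \<noteq> g x"
proof -
  have img: "g ` verts C = verts C"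
    using assms(2) by (simp add: traces_def)
  then have inj: "inj_on g (verts C)"
    using assms(1) by (simp add: eq_card_imp_inj_on)
  define h where "h = inv_into (verts C) g"
  have inv: "h (g x) = x" if "x \<in> verts C" for x
    using inj that by (simp add: h_def)
  have "h x \<noteq> g x" if "x \<in> verts C" for x
  proof -
    obtain z where "z \<in> verts C" "x = g z"
      using img \<open>x \<in> verts C\<close> by blast
    then show ?thesis
      using inv[of z] assms(2) unfolding traces_def by metis
  qed
  with traces_reverse[OF assms(2) inv] that show ?thesis
    by blast
qed

text \<open>A cycle traced by \<^term>\<open>h\<close> is the orbit of each of its vertices, so two of them that share a vertex
coincide. Here a shared vertex is where the orbit of \<^term>\<open>x\<close>, which stays in \<^term>\<open>D\<close>, meets
\<^term>\<open>C\<close>.\<close>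

lemma traces_unique:
  assumes "traces h C" "traces h D" "x \<in> verts D" "(h ^^ n) x \<in> verts C"
  shows "C = D"
proof -
  let ?y = "(h ^^ n) x"
  have D: "?y \<in> verts D"
    using assms(2,3) funpow_in_closed[of h "verts D" x] by (auto simp: traces_def)
  have "verts C = verts D"
    using traces_verts_eq_orbit[OF assms(1,4)] traces_verts_eq_orbit[OF assms(2) D] by simp
  then show ?thesis
    using assms(1,2) by (simp add: traces_def prod_eq_iff)
qed

lemma traces_orbit_graph:
  assumes "n > 0" "(f ^^ n) x = x" "\<And>k. f (f ((f ^^ k) x)) \<noteq> (f ^^ k) x"
  shows "traces f (orbit_graph f x)"
proof -
  have "\<exists>l. (f ^^ l) ((f ^^ i) x) = (f ^^ j) x" for i j
  proof
    \<comment> \<open>Instead of going back by \<^term>\<open>i\<close> steps, complete \<^term>\<open>i\<close> full periods.\<close>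
    have "(f ^^ (j + (n * i - i))) ((f ^^ i) x) = (f ^^ (j + (n * i - i) + i)) x"
      by (simp add: funpow_add)
    also have "j + (n * i - i) + i = j + n * i"
      using assms(1) by (cases n) auto
    finally show "(f ^^ (j + (n * i - i))) ((f ^^ i) x) = (f ^^ j) x"
      using funpow_fixed_mult[OF assms(2)] by (simp add: funpow_add)
  qed
  moreover have "f ` range (\<lambda>k. (f ^^ k) x) = range (\<lambda>k. (f ^^ k) x)"
  proof (intro equalityI subsetI)
    fix y assume "y \<in> range (\<lambda>k. (f ^^ k) x)"
    then obtain k where "y = (f ^^ k) x"
      by auto
    also have "\<dots> = (f ^^ (k + n)) x"
      by (simp add: funpow_add assms(2))
    also have "\<dots> = f ((f ^^ (k + n - 1)) x)"
      using assms(1) by (cases n) auto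
    finally show "y \<in> f ` range (\<lambda>k. (f ^^ k) x)"
      by blast
  qed (auto intro: range_eqI[of _ _ "Suc _"])
  ultimately show ?thesis
    using assms(3) by (auto simp: traces_def orbit_graph_def)
qed

lemma traces_subgraph:
  assumes G: "simple_graph G" and f: "traces f C" "\<And>x. x \<in> verts C \<Longrightarrow> {x, f x} \<in> edges G"
  shows "subgraph C G"
proof -
  have "verts C \<subseteq> verts G"
    using G f(2) unfolding simple_graph_def by blast
  moreover have edges: "edges C \<subseteq> edges G"
    using f by (auto simp: traces_def)
  moreover have "e \<subseteq> verts C \<and> card e = 2" if "e \<in> edges C" for e
  proof
    show "e \<subseteq> verts C"
      using f(1) that by (auto simp: traces_def)
    show "card e = 2"
      using G edges that by (auto simp: simple_graph_def)
  qed
  moreover have "finite (verts C)"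
    using G calculation(1) by (auto simp: simple_graph_def intro: finite_subset)
  ultimately show ?thesis
    by (simp add: subgraph_def simple_graph_def)
qed

text \<open>The length of the orbit divides the odd number \<^term>\<open>m\<close>, so it is not two, and it is not one as \<^term>\<open>f\<close> moves along edges; so it is a genuine cycle.\<close>

lemma odd_cycle_of_odd_period:
  assumes G: "simple_graph G" and adj: "\<And>k. {(f ^^ k) x, (f ^^ Suc k) x} \<in> edges G"
    and m: "odd m" "(f ^^ m) x = x"
  shows "traces f (orbit_graph f x)" "orbit_graph f x \<in> odd_cycles G"
proof -
  let ?C = "orbit_graph f x"
  have "m > 0"
    using m(1) by (rule odd_pos)
  have "f (f ((f ^^ k) x)) \<noteq> (f ^^ k) x" for k
  proof
    let ?y = "(f ^^ k) x"
    assume "f (f ?y) = ?y"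
    then have "(f ^^ 2) ?y = ?y"
      by (simp add: numeral_2_eq_2)
    then have even: "(f ^^ (2 * i)) ?y = ?y" for i
      by (rule funpow_fixed_mult)
    obtain i where "m = Suc (2 * i)"
      using m(1) by (metis oddE Suc_eq_plus1)
    then have "(f ^^ m) ?y = f ?y"
      by (simp add: even)
    moreover have "(f ^^ m) ?y = (f ^^ k) ((f ^^ m) x)"
      by (metis add.commute comp_apply funpow_add)
    ultimately have "f ?y = ?y"
      by (simp add: m(2))
    then show False
      using edge_endpoints_distinct[OF G adj[of k]] by simp
  qed
  then show tr: "traces f ?C"
    using \<open>m > 0\<close> m(2) by (intro traces_orbit_graph)
  have sub: "subgraph ?C G"
    using adj by (intro traces_subgraph[OF G tr]) (auto simp: orbit_graph_def)
  then have fin: "finite (verts ?C)"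
    by (simp add: subgraph_def simple_graph_def)
  have "x \<in> verts ?C"
    by (auto simp: orbit_graph_def intro: range_eqI[of _ _ 0])
  then have "card (verts ?C) dvd m"
    using traces_period(1)[OF fin tr] m(2) by blast
  then have "odd (card (verts ?C))"
    using m(1) by (meson dvd_trans)
  then show "?C \<in> odd_cycles G"
    using sub traces_imp_is_cycle[OF fin tr] traces_card_edges[OF tr]
    by (simp add: odd_cycles_def cycles_def)
qed

section \<open>Maps flowing into a cycle\<close>

abbreviation adj :: "'v graph \<Rightarrow> ('v \<times> 'v) set" where
  "adj G \<equiv> {(x, y). {x, y} \<in> edges G}"

definition basin :: "'v graph \<Rightarrow> 'v set \<Rightarrow> 'v set" where
  "basin G W = {v. \<exists>w\<in>W. (v, w) \<in> (adj G)\<^sup>*}"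

lemma reachable_sym:
  assumes "(u, v) \<in> (adj G)\<^sup>*"
  shows "(v, u) \<in> (adj G)\<^sup>*"
proof -
  have "sym (adj G)"
    by (auto simp: sym_def insert_commute)
  then show ?thesis
    using assms by (meson sym_rtrancl symD)
qed

lemma subset_basin: "W \<subseteq> basin G W"
  by (auto simp: basin_def)

lemma edge_basin_iff:
  assumes "{u, v} \<in> edges G"
  shows "u \<in> basin G W \<longleftrightarrow> v \<in> basin G W"
proof -
  have "x \<in> basin G W" if "(x, y) \<in> adj G" "y \<in> basin G W" for x y
  proof -
    obtain w where "w \<in> W" "(y, w) \<in> (adj G)\<^sup>*"
      using \<open>y \<in> basin G W\<close> unfolding basin_def by blast
    then show ?thesis
      using converse_rtrancl_into_rtrancl[OF \<open>(x, y) \<in> adj G\<close>] unfolding basin_def by blast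
  qed
  moreover have "(u, v) \<in> adj G" "(v, u) \<in> adj G"
    using assms by (simp_all add: insert_commute)
  ultimately show ?thesis
    by blast
qed

text \<open>The function \<^term>\<open>d\<close> is the distance to \<^term>\<open>W\<close>, and \<^term>\<open>g\<close> takes one step of a breadth-first
search backwards.\<close>

lemma descending_neighbour_map_exists:
  obtains g and d :: "'v \<Rightarrow> nat" where
    "\<And>v. v \<in> basin G W - W \<Longrightarrow> {v, g v} \<in> edges G \<and> d (g v) < d v"
proof -
  define d where "d v = (LEAST n. \<exists>w\<in>W. (v, w) \<in> adj G ^^ n)" for v
  have "\<exists>y. {v, y} \<in> edges G \<and> d y < d v" if v: "v \<in> basin G W - W" for v
  proof -
    have "\<exists>n. \<exists>w\<in>W. (v, w) \<in> adj G ^^ n"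
      using v by (auto simp: basin_def rtrancl_power)
    then have "\<exists>w\<in>W. (v, w) \<in> adj G ^^ d v"
      unfolding d_def by (rule LeastI_ex)
    then obtain w where w: "w \<in> W" "(v, w) \<in> adj G ^^ d v"
      by blast
    then have "d v \<noteq> 0"
      using v by (cases "d v") auto
    then obtain m where m: "d v = Suc m"
      using not0_implies_Suc by blast
    then obtain y where y: "(v, y) \<in> adj G" "(y, w) \<in> adj G ^^ m"
      using w(2) by (metis relpow_Suc_D2)
    have "d y \<le> m"
      unfolding d_def using y(2) w(1) by (intro Least_le) blast
    with y(1) m show ?thesis
      by auto
  qed
  then show ?thesis
    using that by metis
qed

lemma descent_reaches:
  fixes d :: "'v \<Rightarrow> nat"
  assumes "\<And>v. v \<in> S - W \<Longrightarrow> h v \<in> S \<and> d (h v) < d v" and "v \<in> S"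
  shows "\<exists>n. (h ^^ n) v \<in> W"
  using assms(2)
proof (induction "d v" arbitrary: v rule: less_induct)
  case less
  show ?case
  proof (cases "v \<in> W")
    case True
    then show ?thesis
      by (intro exI[of _ 0]) simp
  next
    case False
    then obtain n where "(h ^^ n) (h v) \<in> W"
      using less assms(1) by blast
    then show ?thesis
      by (intro exI[of _ "Suc n"]) (simp add: funpow_swap1)
  qed
qed

lemma odd_cycleD:
  assumes "C \<in> odd_cycles G" "traces f C"
  shows "finite (verts C)" "odd (card (verts C))" "\<And>x. x \<in> verts C \<Longrightarrow> {x, f x} \<in> edges G"
    "verts C \<noteq> {}" "f ` verts C = verts C"
proof -
  have sub: "subgraph C G" and odd: "odd (card (edges C))"
    using assms(1) by (simp_all add: odd_cycles_def cycles_def)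
  then show "finite (verts C)"
    by (simp add: subgraph_def simple_graph_def)
  show "odd (card (verts C))"
    using odd traces_card_edges[OF assms(2)] by simp
  have edges: "edges C = (\<lambda>x. {x, f x}) ` verts C"
    using assms(2) by (simp add: traces_def)
  show "{x, f x} \<in> edges G" if "x \<in> verts C" for x
    using that sub edges by (auto simp: subgraph_def)
  show "verts C \<noteq> {}" "f ` verts C = verts C"
    using assms(2) by (simp_all add: traces_def)
qed

lemma odd_maps_edge:
  assumes "h \<in> odd_maps G"
  shows "{x, h x} \<in> edges G"
  using assms by (simp add: odd_maps_def neighbour_maps_def)

lemma odd_map_closed_basin:
  assumes "h \<in> odd_maps G"
  shows "h ` basin G W \<subseteq> basin G W" "h ` (- basin G W) \<subseteq> - basin G W"
  using edge_basin_iff[OF odd_maps_edge[OF assms]] by blast+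

lemma periodic_point_in_closed_set:
  assumes "n > 0" "(h ^^ n) x = x" "h ` W \<subseteq> W" "(h ^^ k) x \<in> W"
  shows "x \<in> W"
proof -
  have "(h ^^ (n * k - k)) ((h ^^ k) x) = (h ^^ (n * k - k + k)) x"
    by (simp add: funpow_add)
  also have "n * k - k + k = n * k"
    using assms(1) by (cases n) auto
  also have "(h ^^ (n * k)) x = x"
    by (rule funpow_fixed_mult[OF assms(2)])
  finally show ?thesis
    using funpow_in_closed[OF assms(3,4), of "n * k - k"] by simp
qed

text \<open>Follow \<^term>\<open>f\<close> on the cycle, a shortest path towards the cycle in the rest of its component, and
\<^term>\<open>h0\<close> in the other components. No periodic points arise in the component besides the
vertices of \<^term>\<open>C\<close>.\<close>

lemma odd_map_extension:
  assumes C: "C \<in> odd_cycles G" "traces f C" and h0: "h0 \<in> odd_maps G"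
  obtains h where "h \<in> odd_maps G" "traces h C" "\<And>x. x \<in> verts C \<Longrightarrow> h x = f x"
    "\<And>v. v \<in> basin G (verts C) \<Longrightarrow> \<exists>n. (h ^^ n) v \<in> verts C"
    "\<And>v. v \<notin> basin G (verts C) \<Longrightarrow> h v = h0 v"
proof -
  let ?W = "verts C" and ?S = "basin G (verts C)"
  obtain g and d :: "'a \<Rightarrow> nat" where g:
    "\<And>v. v \<in> ?S - ?W \<Longrightarrow> {v, g v} \<in> edges G \<and> d (g v) < d v"
    using descending_neighbour_map_exists[of G ?W] by blast
  define h where "h v = (if v \<in> ?W then f v else if v \<in> ?S then g v else h0 v)" for v
  note cyc = odd_cycleD[OF C]
  have sub: "?W \<subseteq> ?S"
    by (rule subset_basin)
  have on_C: "h x = f x" if "x \<in> ?W" for x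
    using that by (simp add: h_def)
  have outside: "h v = h0 v" if "v \<notin> ?S" for v
    using that sub by (auto simp: h_def)
  have edge: "{v, h v} \<in> edges G" for v
    using cyc(3) g odd_maps_edge[OF h0] by (auto simp: h_def)
  have reach: "\<exists>n. (h ^^ n) v \<in> ?W" if "v \<in> ?S" for v
  proof (rule descent_reaches[OF _ that, where d = d])
    fix v assume v: "v \<in> ?S - ?W"
    then have "h v = g v"
      by (simp add: h_def)
    then show "h v \<in> ?S \<and> d (h v) < d v"
      using g[OF v] edge_basin_iff[OF edge[of v], of ?W] v by simp
  qed
  have tr: "traces h C"
    using C(2) on_C by (rule traces_cong)
  \<comment> \<open>Periodic points in the component lie on the cycle; the others are periodic points of \<^term>\<open>h0\<close>.\<close>
  have "odd_periodic h"
    unfolding odd_periodic_def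
  proof (intro allI impI)
    fix x n assume n: "n > 0 \<and> (h ^^ n) x = x"
    show "\<exists>m. odd m \<and> (h ^^ m) x = x"
    proof (cases "x \<in> ?S")
      case True
      then obtain k where k: "(h ^^ k) x \<in> ?W"
        using reach by blast
      have "h ` ?W \<subseteq> ?W"
        using tr by (simp add: traces_def)
      then have "x \<in> ?W"
        using periodic_point_in_closed_set[of n h x ?W k] n k by blast
      then have "(h ^^ card ?W) x = x"
        using traces_period(1)[OF cyc(1) tr] by simp
      with cyc(2) show ?thesis
        by blast
    next
      case False
      then have agree: "(h ^^ k) x = (h0 ^^ k) x" for k
        using outside odd_map_closed_basin(2)[OF h0]
        by (intro funpow_agree_on_closed[of h0 "- ?S"]) auto
      have "odd_periodic h0"
        using h0 by (simp add: odd_maps_def)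
      then show ?thesis
        using n unfolding odd_periodic_def agree by blast
    qed
  qed
  then have "h \<in> odd_maps G"
    using edge by (simp add: odd_maps_def neighbour_maps_def)
  then show ?thesis
    using that tr on_C reach outside by blast
qed

text \<open>In the graph without the edge, let every vertex step closer to \<^term>\<open>v\<close>, and let \<^term>\<open>v\<close> itself
jump to \<^term>\<open>u\<close> along the removed edge. The orbit of \<^term>\<open>v\<close> under this map is the required cycle;
it does not turn back because distances decrease and the edge is crossed in one direction only.\<close>

lemma cycle_through_nonbridge:
  assumes G: "simple_graph G" and e: "{u, v} \<in> edges G"
    and conn: "(u, v) \<in> (adj (verts G, edges G - {{u, v}}))\<^sup>*"
  obtains C where "C \<in> cycles G" "{u, v} \<in> edges C"
proof -
  let ?G' = "(verts G, edges G - {{u, v}})"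
  let ?S = "basin ?G' {v}"
  obtain g and d :: "'a \<Rightarrow> nat" where g:
    "\<And>y. y \<in> ?S - {v} \<Longrightarrow> {y, g y} \<in> edges ?G' \<and> d (g y) < d y"
    using descending_neighbour_map_exists[of ?G' "{v}"] by blast
  define h where "h = g(v := u)"
  have uS: "u \<in> ?S"
    using conn by (simp add: basin_def)
  have hS: "h y \<in> ?S" if "y \<in> ?S" for y
  proof (cases "y = v")
    case False
    then have "{y, g y} \<in> edges ?G'"
      using g[of y] that by blast
    then have "g y \<in> ?S"
      using that by (rule edge_basin_iff[THEN iffD1])
    with False show ?thesis
      by (simp add: h_def)
  qed (simp add: h_def uS)
  have "\<exists>n. (h ^^ n) u \<in> {v}"
  proof (rule descent_reaches[OF _ uS, where d = d])
    fix y assume y: "y \<in> ?S - {v}"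
    then have "h y = g y"
      by (simp add: h_def)
    then show "h y \<in> ?S \<and> d (h y) < d y"
      using g[OF y] hS[of y] y by simp
  qed
  then obtain n where "(h ^^ n) u = v"
    by blast
  then have n: "(h ^^ Suc n) v = v"
    by (simp add: funpow_swap1 h_def)
  have edge: "{y, h y} \<in> edges G" if "y \<in> ?S" for y
    using g[of y] that e by (auto simp: h_def insert_commute)
  have "u \<noteq> v"
    by (rule edge_endpoints_distinct[OF G e])
  have no2: "h (h y) \<noteq> y" if y: "y \<in> ?S" for y
  proof (cases "y = v")
    case True
    then show ?thesis
      using g[of u] uS \<open>u \<noteq> v\<close> by (auto simp: h_def)
  next
    case False
    then have y': "{y, g y} \<in> edges ?G'" "d (g y) < d y"
      using g y by auto
    show ?thesis
    proof (cases "g y = v")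
      case True
      then show ?thesis
        using y'(1) False by (auto simp: h_def insert_commute)
    next
      case False
      then have "d (g (g y)) < d (g y)"
        using g[of "g y"] hS[OF y] \<open>y \<noteq> v\<close> by (simp add: h_def)
      then show ?thesis
        using y'(2) False \<open>y \<noteq> v\<close> by (auto simp: h_def)
    qed
  qed
  have vS: "v \<in> ?S"
    by (simp add: basin_def)
  have orbit: "(h ^^ k) v \<in> ?S" for k
    using hS vS by (intro funpow_in_closed) auto
  let ?C = "orbit_graph h v"
  have tr: "traces h ?C"
    using n no2[OF orbit] by (intro traces_orbit_graph[of "Suc n"]) auto
  have sub: "subgraph ?C G"
    using edge[OF orbit] by (intro traces_subgraph[OF G tr]) (auto simp: orbit_graph_def)
  then have "?C \<in> cycles G"
    using traces_imp_is_cycle[OF _ tr] by (simp add: cycles_def subgraph_def simple_graph_def)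
  moreover have "{u, v} \<in> edges ?C"
    by (auto simp: orbit_graph_def h_def insert_commute intro!: range_eqI[of _ _ 0])
  ultimately show ?thesis
    using that by blast
qed

section \<open>Lower bounds for the contribution of a map\<close>

lemma card_invariant_sets_ge_2:
  fixes h :: "'v::finite \<Rightarrow> 'v"
  shows "card (invariant_sets h) \<ge> 2"
proof -
  obtain X where X: "X \<noteq> {}" "h ` X = X"
    using closed_contains_invariant_set[of UNIV h] by auto
  have "card {{}, X} \<le> card (invariant_sets h)"
    using X by (intro card_mono) (auto simp: invariant_sets_def)
  then show ?thesis
    using X(1) by simp
qed

lemma card_invariant_sets_ge_4:
  fixes h :: "'v::finite \<Rightarrow> 'v"
  assumes "h ` S \<subseteq> S" "h ` (- S) \<subseteq> - S" "S \<noteq> {}" "S \<noteq> UNIV"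
  shows "card (invariant_sets h) \<ge> 4"
proof -
  obtain X where X: "X \<subseteq> S" "X \<noteq> {}" "h ` X = X"
    using closed_contains_invariant_set[of S h] assms by auto
  obtain Y where Y: "Y \<subseteq> - S" "Y \<noteq> {}" "h ` Y = Y"
    using closed_contains_invariant_set[of "- S" h] assms by auto
  have "h ` (X \<union> Y) = X \<union> Y"
    using X(3) Y(3) by (simp add: image_Un)
  then have "card {{}, X, Y, X \<union> Y} \<le> card (invariant_sets h)"
    using X Y by (intro card_mono) (auto simp: invariant_sets_def)
  moreover have "card {{}, X, Y, X \<union> Y} = 4"
  proof -
    have "X \<noteq> Y" "X \<union> Y \<noteq> X" "X \<union> Y \<noteq> Y"
      using X(1,2) Y(1,2) by blast+
    then show ?thesis
      using X(2) Y(2) by auto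
  qed
  ultimately show ?thesis
    by simp
qed

section \<open>Bipartite graphs and singular signless Laplacians\<close>

lemma bipartite_closed_orbit_even:
  assumes "bipartite G" and edge: "\<And>k. {(f ^^ k) x, (f ^^ Suc k) x} \<in> edges G"
    and "(f ^^ m) x = x"
  shows "even m"
proof -
  obtain X Y where XY: "X \<inter> Y = {}" "\<And>e. e \<in> edges G \<Longrightarrow> \<exists>x\<in>X. \<exists>y\<in>Y. e = {x, y}"
    using assms(1) unfolding bipartite_def by metis
  have switch: "b \<in> X \<longleftrightarrow> a \<notin> X" if ab: "{a, b} \<in> edges G" for a b
    using XY(1) XY(2)[OF ab] by (auto simp: doubleton_eq_iff)
  have "(f ^^ k) x \<in> X \<longleftrightarrow> (x \<in> X \<longleftrightarrow> even k)" for k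
  proof (induction k)
    case (Suc k)
    then show ?case
      using switch[OF edge[of k]] by simp
  qed simp
  from this[of m] show ?thesis
    using assms(3) by (cases "x \<in> X") simp_all
qed

lemma bipartite_no_odd_cycles:
  assumes "bipartite G"
  shows "odd_cycles G = {}"
proof (rule equals0I)
  fix C assume C: "C \<in> odd_cycles G"
  then have "is_cycle C"
    by (simp add: odd_cycles_def cycles_def)
  then obtain f where f: "traces f C"
    by (rule is_cycle_imp_traces)
  note cyc = odd_cycleD[OF C f]
  obtain x where x: "x \<in> verts C"
    using cyc(4) by blast
  have "(f ^^ k) x \<in> verts C" for k
    using funpow_in_closed[of f "verts C" x] cyc(5) x by simp
  then have "{(f ^^ k) x, (f ^^ Suc k) x} \<in> edges G" for k
    using cyc(3) by simp
  moreover have "(f ^^ card (verts C)) x = x"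
    using traces_period(1)[OF cyc(1) f x] by simp
  ultimately have "even (card (verts C))"
    by (rule bipartite_closed_orbit_even[OF assms])
  then show False
    using cyc(2) by simp
qed

lemma bipartite_no_odd_maps:
  fixes G :: "'v::finite graph"
  assumes "bipartite G"
  shows "odd_maps G = {}"
proof (rule equals0I)
  fix h assume h: "h \<in> odd_maps G"
  obtain X where X: "X \<noteq> {}" "h ` X = X"
    using closed_contains_invariant_set[of UNIV h] by auto
  then obtain x where "x \<in> X"
    by blast
  then obtain n where "n > 0" "(h ^^ n) x = x"
    using invariant_set_periodic[OF _ X(2)] by auto
  then obtain m where m: "odd m" "(h ^^ m) x = x"
    using h unfolding odd_maps_def odd_periodic_def by blast
  have "{(h ^^ k) x, (h ^^ Suc k) x} \<in> edges G" for k
    using odd_maps_edge[OF h] by simp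
  then have "even m"
    using m(2) by (rule bipartite_closed_orbit_even[OF assms])
  with m(1) show False
    by simp
qed

text \<open>The quadratic form of the signless Laplacian is the sum of \<open>(x\<^sub>u + x\<^sub>v)\<^sup>2\<close> over the edges, so it
vanishes only if every summand does.\<close>

lemma kernel_alternates:
  fixes G :: "'v::finite graph"
  assumes G: "simple_graph G" and x: "signless_laplacian G *v x = 0" and edge: "{u, v} \<in> edges G"
  shows "x $ u = - x $ v"
proof -
  define a :: "'v \<Rightarrow> 'v \<Rightarrow> real" where "a i j = (if {i, j} \<in> edges G then 1 else 0)" for i j
  have a_sym: "a i j = a j i" for i j
    by (simp add: a_def insert_commute)
  have "(\<Sum>j\<in>UNIV. a i j * (x $ i + x $ j)) = 0" for i
  proof -
    have deg: "real (degree G i) = (\<Sum>j\<in>UNIV. a i j)"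
      by (simp add: degree_eq_card_neighbours[OF G] a_def sum.If_cases)
    have "(signless_laplacian G *v x) $ i = (\<Sum>j\<in>UNIV. ((if i = j then real (degree G i) else 0) + a i j) * x $ j)"
      by (simp add: matrix_vector_mult_def signless_laplacian_def degree_matrix_def
          adjacency_matrix_def a_def)
    also have "\<dots> = real (degree G i) * x $ i + (\<Sum>j\<in>UNIV. a i j * x $ j)"
      by (simp add: distrib_right sum.distrib if_distrib[of "\<lambda>c. c * _"] cong: if_cong)
    also have "\<dots> = (\<Sum>j\<in>UNIV. a i j * (x $ i + x $ j))"
      by (simp add: deg distrib_left sum.distrib sum_distrib_right)
    finally show ?thesis
      by (simp add: x)
  qed
  then have 1: "(\<Sum>i\<in>UNIV. \<Sum>j\<in>UNIV. x $ i * (a i j * (x $ i + x $ j))) = 0"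
    by (simp flip: sum_distrib_left)
  then have 2: "(\<Sum>i\<in>UNIV. \<Sum>j\<in>UNIV. x $ j * (a i j * (x $ i + x $ j))) = 0"
    by (subst sum.swap) (simp add: a_sym add.commute)
  \<comment> \<open>Each edge is counted twice here, once from either end.\<close>
  have "(\<Sum>i\<in>UNIV. \<Sum>j\<in>UNIV. a i j * (x $ i + x $ j)\<^sup>2) = 0"
  proof -
    have "a i j * (x $ i + x $ j)\<^sup>2
        = x $ i * (a i j * (x $ i + x $ j)) + x $ j * (a i j * (x $ i + x $ j))" for i j
      by (simp add: power2_eq_square algebra_simps)
    then show ?thesis
      using 1 2 by (simp add: sum.distrib)
  qed
  then have "a u v * (x $ u + x $ v)\<^sup>2 = 0"
    by (simp add: sum_nonneg_eq_0_iff sum_nonneg a_def)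
  then show ?thesis
    using edge by (simp add: a_def)
qed

lemma reachable_component:
  assumes G: "simple_graph G" and v: "v \<in> verts G"
    and K: "K = {w. (v, w) \<in> (adj G)\<^sup>*}"
  shows "component (K, {e \<in> edges G. e \<subseteq> K}) G"
proof -
  let ?C = "(K, {e \<in> edges G. e \<subseteq> K})"
  have "v \<in> K"
    by (simp add: K)
  have "w \<in> verts G" if "(v, w) \<in> (adj G)\<^sup>*" for w
    using that v G by induction (auto simp: simple_graph_def)
  then have KV: "K \<subseteq> verts G"
    by (auto simp: K)
  have C_sub: "subgraph ?C G"
    using G KV by (auto simp: subgraph_def simple_graph_def intro: finite_subset)
  have "(v, w) \<in> (adj ?C)\<^sup>*" if "(v, w) \<in> (adj G)\<^sup>*" for w
    using that
  proof induction
    case (step y z)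
    then have "{y, z} \<in> edges ?C"
      by (auto simp: K intro: rtrancl_into_rtrancl)
    with step.IH show ?case
      by (auto intro: rtrancl_into_rtrancl)
  qed simp
  then have reach: "(v, w) \<in> (adj ?C)\<^sup>*" if "w \<in> K" for w
    using that by (simp add: K)
  have "(u, w) \<in> (adj ?C)\<^sup>*" if "u \<in> K" "w \<in> K" for u w
    using reachable_sym[OF reach[OF that(1)]] reach[OF that(2)] by (rule rtrancl_trans)
  then have C_conn: "connected_graph ?C"
    using \<open>v \<in> K\<close> by (auto simp: connected_graph_def)
  have "H = ?C" if H: "subgraph H G" "connected_graph H" "subgraph ?C H" for H
  proof -
    have "w \<in> K" if w: "w \<in> verts H" for w
    proof -
      have "v \<in> verts H"
        using \<open>v \<in> K\<close> H(3) by (auto simp: subgraph_def)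
      then have "(v, w) \<in> (adj H)\<^sup>*"
        using H(2) w unfolding connected_graph_def by blast
      moreover have "adj H \<subseteq> adj G"
        using H(1) by (auto simp: subgraph_def)
      ultimately show ?thesis
        using rtrancl_mono by (auto simp: K)
    qed
    then have "verts H = K"
      using H(3) by (auto simp: subgraph_def)
    moreover from this have "edges H = {e \<in> edges G. e \<subseteq> K}"
      using H(1,3) by (auto simp: subgraph_def simple_graph_def)
    ultimately show ?thesis
      by (simp add: prod_eq_iff)
  qed
  with C_sub C_conn show ?thesis
    by (auto simp: component_def)
qed

text \<open>A nonzero kernel vector changes sign along every edge. On the component of a vertex where it does
not vanish its absolute value is constant and positive, and its sign is a bipartition.\<close>

lemma singular_imp_bipartite_component:
  fixes G :: "'v::finite graph"
  assumes G: "simple_graph G" and V: "verts G = UNIV" and "det (signless_laplacian G) = 0"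
  obtains C where "component C G" "bipartite C"
proof -
  have "\<not> invertible (signless_laplacian G)"
    using assms(3) by (simp add: invertible_det_nz)
  then obtain x where x: "signless_laplacian G *v x = 0" "x \<noteq> 0"
    using matrix_left_invertible_ker invertible_left_inverse by blast
  then obtain v where v: "x $ v \<noteq> 0"
    by (auto simp: vec_eq_iff)
  define K where "K = {w. (v, w) \<in> (adj G)\<^sup>*}"
  have "x $ w = x $ v \<or> x $ w = - x $ v" if "(v, w) \<in> (adj G)\<^sup>*" for w
    using that by induction (use kernel_alternates[OF G x(1)] in auto)
  then have K: "x $ w = x $ v \<or> x $ w = - x $ v" if "w \<in> K" for w
    using that by (simp add: K_def)
  define X where "X = {w \<in> K. x $ w = x $ v}"
  define Y where "Y = {w \<in> K. x $ w = - x $ v}"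
  have "\<exists>a\<in>X. \<exists>b\<in>Y. e = {a, b}" if e: "e \<in> edges G" "e \<subseteq> K" for e
  proof -
    obtain a b where ab: "e = {a, b}"
      using G e(1) unfolding simple_graph_def by (metis card_2_iff)
    then have "x $ a = - x $ b"
      using kernel_alternates[OF G x(1)] e(1) by blast
    then have "a \<in> X \<and> b \<in> Y \<or> b \<in> X \<and> a \<in> Y"
      using K[of a] K[of b] e(2) ab by (auto simp: X_def Y_def)
    then show ?thesis
      using ab by (auto simp: insert_commute)
  qed
  moreover have "X \<union> Y = K" "X \<inter> Y = {}"
    using K v by (auto simp: X_def Y_def)
  ultimately have "bipartite (K, {e \<in> edges G. e \<subseteq> K})"
    unfolding bipartite_def by (intro exI[of _ X] exI[of _ Y]) auto
  moreover have "component (K, {e \<in> edges G. e \<subseteq> K}) G"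
    by (rule reachable_component[OF G _ K_def]) (simp add: V)
  ultimately show ?thesis
    using that by blast
qed

section \<open>Counting odd maps by the cycle they trace\<close>

text \<open>In a connected graph every odd cycle is traced by at least two such maps, one for each direction,
and each map determines its cycle; this is what bounds the determinant from below.\<close>

definition cycle_maps :: "'v graph \<Rightarrow> 'v graph \<Rightarrow> ('v \<Rightarrow> 'v) set" where
  "cycle_maps G C =
     {h \<in> odd_maps G. traces h C \<and> (\<forall>v. \<exists>n. (h ^^ n) v \<in> verts C)}"

lemma cycle_maps_unique:
  assumes "h \<in> cycle_maps G C" "traces h D"
  shows "D = C"
proof -
  obtain x where x: "x \<in> verts D"
    using assms(2) by (auto simp: traces_def)
  obtain n where "(h ^^ n) x \<in> verts C"
    using assms(1) by (auto simp: cycle_maps_def)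
  then show ?thesis
    using traces_unique[of h C D x n] assms x by (simp add: cycle_maps_def)
qed

text \<open>Different cycles have disjoint sets of maps, and each map has at least two invariant sets.\<close>

lemma sum_card_cycle_maps_le:
  fixes G :: "'v::finite graph"
  shows "2 * (\<Sum>C\<in>odd_cycles G. card (cycle_maps G C))
    \<le> (\<Sum>h\<in>odd_maps G. card (invariant_sets h))"
proof -
  let ?U = "\<Union>C\<in>odd_cycles G. cycle_maps G C"
  have "cycle_maps G C \<inter> cycle_maps G D = {}" if "C \<noteq> D" for C D
    using cycle_maps_unique that by (fastforce simp: cycle_maps_def)
  then have "(\<Sum>C\<in>odd_cycles G. card (cycle_maps G C)) = card ?U"
    by (subst card_UN_disjoint) auto
  also have "card ?U \<le> card (odd_maps G)"
    by (intro card_mono) (auto simp: cycle_maps_def)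
  finally have "2 * (\<Sum>C\<in>odd_cycles G. card (cycle_maps G C)) \<le> (\<Sum>h\<in>odd_maps G. 2)"
    by simp
  also have "\<dots> \<le> (\<Sum>h\<in>odd_maps G. card (invariant_sets h))"
    by (intro sum_mono card_invariant_sets_ge_2)
  finally show ?thesis .
qed

lemma both_orientations_extend:
  assumes C: "C \<in> odd_cycles G" and h0: "h0 \<in> odd_maps G"
  obtains h h' where "\<And>x. x \<in> verts C \<Longrightarrow> h x \<noteq> h' x"
    "\<And>k. k \<in> {h, h'} \<Longrightarrow> k \<in> odd_maps G \<and> traces k C
      \<and> (\<forall>v\<in>basin G (verts C). \<exists>n. (k ^^ n) v \<in> verts C)
      \<and> (\<forall>v. v \<notin> basin G (verts C) \<longrightarrow> k v = h0 v)"
proof -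
  have "is_cycle C"
    using C by (simp add: odd_cycles_def cycles_def)
  then obtain f where f: "traces f C"
    by (rule is_cycle_imp_traces)
  obtain f' where f': "traces f' C" "\<And>x. x \<in> verts C \<Longrightarrow> f' x \<noteq> f x"
    using traces_reverse_exists[OF odd_cycleD(1)[OF C f] f] by blast
  obtain h where h: "h \<in> odd_maps G" "traces h C" "\<And>x. x \<in> verts C \<Longrightarrow> h x = f x"
    "\<And>v. v \<in> basin G (verts C) \<Longrightarrow> \<exists>n. (h ^^ n) v \<in> verts C"
    "\<And>v. v \<notin> basin G (verts C) \<Longrightarrow> h v = h0 v"
    by (rule odd_map_extension[OF C f h0]) (rule that)
  obtain h' where h': "h' \<in> odd_maps G" "traces h' C" "\<And>x. x \<in> verts C \<Longrightarrow> h' x = f' x"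
    "\<And>v. v \<in> basin G (verts C) \<Longrightarrow> \<exists>n. (h' ^^ n) v \<in> verts C"
    "\<And>v. v \<notin> basin G (verts C) \<Longrightarrow> h' v = h0 v"
    by (rule odd_map_extension[OF C f'(1) h0]) (rule that)
  show ?thesis
  proof (rule that)
    show "h x \<noteq> h' x" if "x \<in> verts C" for x
      using h(3) h'(3) f'(2) that by metis
  qed (use h h' in blast)
qed

lemma connected_basin_eq_UNIV:
  assumes "connected_graph G" "verts G = UNIV" "W \<noteq> {}"
  shows "basin G W = UNIV"
  using assms by (auto simp: connected_graph_def basin_def)

lemma cycle_maps_two_orientations:
  assumes conn: "connected_graph G" and V: "verts G = UNIV"
    and C: "C \<in> odd_cycles G" and h0: "h0 \<in> odd_maps G"
  obtains h h' where "h \<in> cycle_maps G C" "h' \<in> cycle_maps G C"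
    "\<And>x. x \<in> verts C \<Longrightarrow> h x \<noteq> h' x"
proof -
  obtain h h' where hh: "\<And>x. x \<in> verts C \<Longrightarrow> h x \<noteq> h' x"
    "\<And>k. k \<in> {h, h'} \<Longrightarrow> k \<in> odd_maps G \<and> traces k C
      \<and> (\<forall>v\<in>basin G (verts C). \<exists>n. (k ^^ n) v \<in> verts C)
      \<and> (\<forall>v. v \<notin> basin G (verts C) \<longrightarrow> k v = h0 v)"
    by (rule both_orientations_extend[OF C h0]) (rule that)
  have "verts C \<noteq> {}"
    using hh(2)[of h] by (simp add: traces_def)
  then have "basin G (verts C) = UNIV"
    by (rule connected_basin_eq_UNIV[OF conn V])
  then have "k \<in> cycle_maps G C" if "k \<in> {h, h'}" for k
    using hh(2)[OF that] by (simp add: cycle_maps_def)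
  then show ?thesis
    using that hh(1) by blast
qed

section \<open>Connected graphs: when is the bound attained?\<close>

text \<open>The edge from \<^term>\<open>a\<close> back to \<^term>\<open>b\<close> closes up the even stretch of the cycle that leads from
\<^term>\<open>b\<close> to \<^term>\<open>a\<close>. The remaining stretch of the cycle has more than one edge, so the new odd
cycle is shorter.\<close>

lemma shortcut_odd_cycle:
  assumes G: "simple_graph G" and h: "h \<in> odd_maps G" and tr: "traces h C" and fin: "finite (verts C)"
    and b: "b \<in> verts C" and i: "i < card (verts C)" "even i" "(h ^^ i) b = a"
    and e: "{a, b} \<in> edges G" "h a \<noteq> b"
  obtains D where "D \<in> odd_cycles G" "card (verts D) < card (verts C)"
proof -
  let ?L = "card (verts C)"
  have "(\<lambda>k. (h ^^ k) b) ` {..<?L} = verts C"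
    using traces_period(2)[OF fin tr b] by simp
  then have inj: "inj_on (\<lambda>k. (h ^^ k) b) {..<?L}"
    by (intro eq_card_imp_inj_on) simp_all
  have first: "(h ^^ k) b \<noteq> a" if "k < i" for k
    using inj_onD[OF inj, of k i] that i by auto
  have "Suc i \<noteq> ?L"
  proof
    assume "Suc i = ?L"
    then have "(h ^^ Suc i) b = b"
      using traces_period(1)[OF fin tr b] by simp
    then show False
      using i(3) e(2) by simp
  qed
  \<comment> \<open>The cycle is cut short: from \<^term>\<open>a\<close> the map returns to \<^term>\<open>b\<close> at once.\<close>
  define f where "f = h(a := b)"
  have agree: "(f ^^ k) b = (h ^^ k) b" if "k \<le> i" for k
    using that by (induction k) (use first in \<open>auto simp: f_def\<close>)
  have period: "(f ^^ Suc i) b = b"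
    using agree[of i] i(3) by (simp add: f_def)
  have "{y, f y} \<in> edges G" for y
    using e(1) odd_maps_edge[OF h] by (simp add: f_def)
  then have D: "orbit_graph f b \<in> odd_cycles G"
    using odd_cycle_of_odd_period(2)[OF G _ _ period] i(2) by simp
  have "(f ^^ k) b \<in> (\<lambda>k. (h ^^ k) b) ` {..i}" for k
  proof
    show "(f ^^ k) b = (h ^^ (k mod Suc i)) b"
      using funpow_mod_eq[OF period, of k] agree[of "k mod Suc i"]
      by (metis less_Suc_eq_le mod_less_divisor zero_less_Suc)
    show "k mod Suc i \<in> {..i}"
      by (simp add: less_Suc_eq_le[symmetric])
  qed
  then have "verts (orbit_graph f b) \<subseteq> (\<lambda>k. (h ^^ k) b) ` {..i}"
    by (auto simp: orbit_graph_def)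
  then have "card (verts (orbit_graph f b)) \<le> Suc i"
    by (metis card_atMost finite_atMost surj_card_le)
  also have "Suc i < ?L"
    using i(1) \<open>Suc i \<noteq> ?L\<close> by simp
  finally show ?thesis
    using that D by blast
qed

text \<open>Since \<^term>\<open>b\<close> flows into the cycle without passing \<^term>\<open>a\<close>, sending \<^term>\<open>a\<close> to \<^term>\<open>b\<close>
creates no new cycle. For the same reason \<^term>\<open>a\<close> is not on \<^term>\<open>C\<close>: the orbit of \<^term>\<open>b\<close>
contains all of \<^term>\<open>C\<close>.\<close>

lemma cycle_maps_redirect:
  assumes h: "h \<in> cycle_maps G C" and C: "C \<in> odd_cycles G"
    and e: "{a, b} \<in> edges G" and avoid: "\<And>n. (h ^^ n) b \<noteq> a"
  shows "h(a := b) \<in> cycle_maps G C" "a \<notin> verts C"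
proof -
  let ?h = "h(a := b)"
  have h': "h \<in> odd_maps G" "traces h C" "\<And>v. \<exists>n. (h ^^ n) v \<in> verts C"
    using h by (auto simp: cycle_maps_def)
  obtain n where n: "(h ^^ n) b \<in> verts C"
    using h'(3) by blast
  show a: "a \<notin> verts C"
  proof
    assume "a \<in> verts C"
    then obtain m where "(h ^^ m) ((h ^^ n) b) = a"
      using h'(2) n unfolding traces_def by blast
    then have "(h ^^ (m + n)) b = a"
      by (simp add: funpow_add)
    then show False
      using avoid by blast
  qed
  have tr: "traces ?h C"
    by (rule traces_cong[OF h'(2)]) (use a in auto)
  have "(?h ^^ k) b = (h ^^ k) b" for k
    by (induction k) (use avoid in auto)
  then have b: "(?h ^^ n) b \<in> verts C"
    using n by simp
  have "\<exists>n. (?h ^^ n) w \<in> verts C" if "(h ^^ k) w \<in> verts C" for k w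
    using that
  proof (induction k arbitrary: w)
    case 0
    then show ?case
      by (intro exI[of _ 0]) simp
  next
    case (Suc k)
    have "\<exists>n. (?h ^^ n) (?h w) \<in> verts C"
    proof (cases "w = a")
      case True
      then show ?thesis
        using b by auto
    next
      case False
      then have "?h w = h w"
        by (rule fun_upd_other)
      moreover have "(h ^^ k) (h w) \<in> verts C"
        using Suc.prems by (simp add: funpow_swap1)
      ultimately show ?thesis
        using Suc.IH[of "h w"] by (simp only:)
    qed
    then obtain n where "(?h ^^ n) (?h w) \<in> verts C"
      by blast
    then show ?case
      by (intro exI[of _ "Suc n"]) (simp only: funpow_Suc_right o_def)
  qed
  then have reach: "\<exists>n. (?h ^^ n) v \<in> verts C" for v
    using h'(3) by blast
  note cyc = odd_cycleD[OF C tr]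
  have "odd_periodic ?h"
    unfolding odd_periodic_def
  proof (intro allI impI)
    fix x n assume n: "n > 0 \<and> (?h ^^ n) x = x"
    obtain k where "(?h ^^ k) x \<in> verts C"
      using reach by blast
    then have "x \<in> verts C"
      using periodic_point_in_closed_set[of n ?h x "verts C" k] n cyc(5) by blast
    then have "(?h ^^ card (verts C)) x = x"
      using traces_period(1)[OF cyc(1) tr] by simp
    with cyc(2) show "\<exists>m. odd m \<and> (?h ^^ m) x = x"
      by blast
  qed
  moreover have "{y, ?h y} \<in> edges G" for y
    using e odd_maps_edge[OF h'(1)] by simp
  ultimately show "?h \<in> cycle_maps G C"
    using tr reach by (simp add: cycle_maps_def odd_maps_def neighbour_maps_def)
qed

text \<open>Suppose that \<^term>\<open>h\<close> does not use the edge \<^term>\<open>{u, v}\<close>. If one end is not in the orbit of the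
other, \<^term>\<open>h\<close> can be redirected along the edge. Otherwise both ends are periodic, so the edge is a
chord of \<^term>\<open>C\<close>; it splits the odd cycle into two stretches, one of them of even length, which
the chord completes to a shorter odd cycle.\<close>

lemma third_cycle_map:
  fixes G :: "'v::finite graph"
  assumes G: "simple_graph G" and C: "C \<in> odd_cycles G"
    and shortest: "\<And>D. D \<in> odd_cycles G \<Longrightarrow> card (verts C) \<le> card (verts D)"
    and h: "h \<in> cycle_maps G C" and h': "h' \<in> cycle_maps G C"
    and differ: "\<And>x. x \<in> verts C \<Longrightarrow> h x \<noteq> h' x"
    and e: "{u, v} \<in> edges G" "\<And>x. {x, h x} \<noteq> {u, v}"
  shows "card (cycle_maps G C) \<ge> 3"
proof -
  have h_facts: "h \<in> odd_maps G" "traces h C" "\<And>v. \<exists>n. (h ^^ n) v \<in> verts C"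
    using h by (auto simp: cycle_maps_def)
  note cyc = odd_cycleD[OF C h_facts(2)]
  have three: ?thesis if ab: "{a, b} \<in> edges G" "h a \<noteq> b" "\<And>n. (h ^^ n) b \<noteq> a" for a b
  proof -
    note redirect = cycle_maps_redirect[OF h C ab(1,3)]
    obtain x where x: "x \<in> verts C"
      using cyc(4) by blast
    have "h \<noteq> h'" "h(a := b) \<noteq> h'"
      using differ[OF x] redirect(2) x by (metis fun_upd_other)+
    moreover have "h \<noteq> h(a := b)"
      using ab(2) by (metis fun_upd_same)
    ultimately have "card {h, h', h(a := b)} = 3"
      by simp
    moreover have "card {h, h', h(a := b)} \<le> card (cycle_maps G C)"
      using h h' redirect(1) by (intro card_mono) auto
    ultimately show ?thesis
      by simp
  qed
  have uv: "h u \<noteq> v" "h v \<noteq> u" "{v, u} \<in> edges G"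
    using e(2)[of u] e(2)[of v] e(1) by (auto simp: insert_commute)
  show ?thesis
  proof (cases "(\<forall>n. (h ^^ n) v \<noteq> u) \<or> (\<forall>n. (h ^^ n) u \<noteq> v)")
    case True
    then show ?thesis
      using three[of u v] three[of v u] e(1) uv by blast
  next
    case False
    then obtain i j where ij: "(h ^^ i) v = u" "(h ^^ j) u = v"
      by blast
    have "u \<noteq> v"
      by (rule edge_endpoints_distinct[OF G e(1)])
    then have "j + i > 0"
      using ij(1) by (cases i) auto
    moreover have "(h ^^ (j + i)) v = v"
      using ij by (simp add: funpow_add)
    moreover obtain k where "(h ^^ k) v \<in> verts C"
      using h_facts(3) by blast
    ultimately have v: "v \<in> verts C"
      using periodic_point_in_closed_set[of "j + i" h v "verts C" k] cyc(5) by blast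
    then have u: "u \<in> verts C"
      using funpow_in_closed[of h "verts C" v i] cyc(5) ij(1) by simp
    let ?L = "card (verts C)"
    have "u \<in> (\<lambda>k. (h ^^ k) v) ` {..<?L}"
      by (rule subst[OF traces_period(2)[OF cyc(1) h_facts(2) v], of "\<lambda>S. u \<in> S"]) (rule u)
    then obtain l where l: "l < ?L" "(h ^^ l) v = u"
      by blast
    have "\<exists>D\<in>odd_cycles G. card (verts D) < ?L"
    proof (cases "even l")
      case True
      show ?thesis
        using shortcut_odd_cycle[OF G h_facts(1,2) cyc(1) v l(1) True l(2) e(1) uv(1)] by blast
    next
      case False
      have "(h ^^ (?L - l)) u = (h ^^ (?L - l + l)) v"
        using l(2) by (simp add: funpow_add)
      also have "\<dots> = v"
        using l(1) traces_period(1)[OF cyc(1) h_facts(2) v] by simp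
      finally have "(h ^^ (?L - l)) u = v" .
      moreover have "even (?L - l)" "?L - l < ?L"
        using False cyc(2) l(1) odd_pos[OF False] by auto
      ultimately show ?thesis
        using shortcut_odd_cycle[OF G h_facts(1,2) cyc(1) u _ _ _ uv(3,2)] by blast
    qed
    then show ?thesis
      using shortest by (meson not_le)
  qed
qed

text \<open>Each edge of another cycle is used by \<^term>\<open>h\<close> in one of its two directions, so \<^term>\<open>h\<close> traces
that cycle as well, in one direction or the other. But every vertex flows into \<^term>\<open>C\<close>.\<close>

lemma unique_cycle_if_no_other_edges:
  assumes C: "C \<in> cycles G" and h: "h \<in> cycle_maps G C"
    and edges: "\<And>e. e \<in> edges G \<Longrightarrow> \<exists>x. e = {x, h x}"
  shows "cycles G = {C}"
proof -
  have "D = C" if D: "D \<in> cycles G" for D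
  proof -
    have "is_cycle D" and sub: "edges D \<subseteq> edges G"
      using D by (simp_all add: cycles_def subgraph_def)
    then obtain g where g: "traces g D"
      using is_cycle_imp_traces by blast
    have "h x = g x \<or> h (g x) = x" if "x \<in> verts D" for x
    proof -
      have "{x, g x} \<in> edges G"
        using g sub that by (auto simp: traces_def)
      then obtain y where "{x, g x} = {y, h y}"
        using edges by blast
      then show ?thesis
        by (auto simp: doubleton_eq_iff)
    qed
    then have "traces h D"
      by (rule traces_if_follows_edges[OF g])
    then show ?thesis
      by (rule cycle_maps_unique[OF h])
  qed
  with C show ?thesis
    by blast
qed

text \<open>An invariant set consists of periodic points, and these lie on the only cycle of \<^term>\<open>h\<close>; on the
other hand it contains, with any point, the cycle into which the point flows.\<close>

lemma invariant_sets_cycle_map: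
  fixes G :: "'v::finite graph"
  assumes "h \<in> cycle_maps G C"
  shows "invariant_sets h = {{}, verts C}"
proof -
  have h: "traces h C" "\<And>v. \<exists>n. (h ^^ n) v \<in> verts C"
    using assms by (auto simp: cycle_maps_def)
  have img: "h ` verts C = verts C"
    using h(1) by (simp add: traces_def)
  have "X = verts C" if X: "h ` X = X" "X \<noteq> {}" for X
  proof
    show "X \<subseteq> verts C"
    proof
      fix x assume "x \<in> X"
      then obtain n where "n > 0" "(h ^^ n) x = x"
        using invariant_set_periodic[OF _ X(1)] by auto
      moreover obtain k where "(h ^^ k) x \<in> verts C"
        using h(2) by blast
      ultimately show "x \<in> verts C"
        using periodic_point_in_closed_set[of n h x "verts C" k] img by blast
    qed
    then obtain x where x: "x \<in> X" "x \<in> verts C"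
      using X(2) by blast
    show "verts C \<subseteq> X"
      using traces_verts_eq_orbit[OF h(1) x(2)] funpow_in_closed[of h X x] X(1) x(1) by auto
  qed
  then show ?thesis
    using img by (auto simp: invariant_sets_def)
qed

lemma odd_map_traces_periodic:
  assumes G: "simple_graph G" and h: "h \<in> odd_maps G" and n: "n > 0" "(h ^^ n) x = x"
  shows "traces h (orbit_graph h x)" "orbit_graph h x \<in> odd_cycles G"
proof -
  obtain m where m: "odd m" "(h ^^ m) x = x"
    using h n unfolding odd_maps_def odd_periodic_def by blast
  have "{(h ^^ k) x, (h ^^ Suc k) x} \<in> edges G" for k
    using odd_maps_edge[OF h] by simp
  then show "traces h (orbit_graph h x)" "orbit_graph h x \<in> odd_cycles G"
    using odd_cycle_of_odd_period[OF G _ m] by blast+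
qed

lemma start_in_orbit_graph: "x \<in> verts (orbit_graph f x)"
  by (auto simp: orbit_graph_def intro: range_eqI[of _ _ 0])

lemma odd_map_no_2_cycle:
  assumes "simple_graph G" "h \<in> odd_maps G"
  shows "h (h x) \<noteq> x"
proof
  assume "h (h x) = x"
  then have "traces h (orbit_graph h x)"
    using odd_map_traces_periodic(1)[OF assms, of 2] by (simp add: numeral_2_eq_2)
  then show False
    using start_in_orbit_graph[of x h] \<open>h (h x) = x\<close> unfolding traces_def by blast
qed

lemma periodic_point_in_orbit:
  fixes h :: "'v::finite \<Rightarrow> 'v"
  obtains k n where "n > 0" "(h ^^ n) ((h ^^ k) v) = (h ^^ k) v"
proof -
  let ?O = "range (\<lambda>k. (h ^^ k) v)"
  have "h ` ?O \<subseteq> ?O"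
    by (auto intro: range_eqI[of _ _ "Suc _"])
  then obtain X where X: "X \<subseteq> ?O" "X \<noteq> {}" "h ` X = X"
    using closed_contains_invariant_set[of ?O h] by auto
  then obtain k where k: "(h ^^ k) v \<in> X"
    by blast
  obtain n where "n > 0" "(h ^^ n) ((h ^^ k) v) = (h ^^ k) v"
    using invariant_set_periodic[OF _ X(3) k] by auto
  then show ?thesis
    by (rule that)
qed

lemma odd_maps_unicyclic:
  fixes G :: "'v::finite graph"
  assumes G: "simple_graph G" and unique: "cycles G = {C}"
  shows "odd_maps G = cycle_maps G C"
proof (intro equalityI subsetI)
  fix h assume h: "h \<in> odd_maps G"
  have cycle: "traces h C \<and> x \<in> verts C" if "n > 0" "(h ^^ n) x = x" for x n
  proof -
    have "orbit_graph h x = C"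
      using odd_map_traces_periodic(2)[OF G h that] unique by (simp add: odd_cycles_def)
    then show ?thesis
      using odd_map_traces_periodic(1)[OF G h that] start_in_orbit_graph[of x h] by simp
  qed
  have "traces h C \<and> (\<exists>k. (h ^^ k) v \<in> verts C)" for v
  proof -
    obtain k n where "n > 0" "(h ^^ n) ((h ^^ k) v) = (h ^^ k) v"
      by (rule periodic_point_in_orbit)
    then show ?thesis
      using cycle by blast
  qed
  then show "h \<in> cycle_maps G C"
    using h by (simp add: cycle_maps_def)
qed (simp add: cycle_maps_def)

text \<open>The edges used by \<^term>\<open>h\<close> connect the whole graph, because every vertex flows into \<^term>\<open>C\<close>. An
unused edge would therefore lie on a cycle other than \<^term>\<open>C\<close>.\<close>

lemma unicyclic_edges:
  fixes G :: "'v::finite graph"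
  assumes G: "simple_graph G" and unique: "cycles G = {C}" and h: "h \<in> cycle_maps G C"
    and e: "{u, v} \<in> edges G"
  shows "\<exists>x. {u, v} = {x, h x}"
proof (rule ccontr)
  assume no: "\<nexists>x. {u, v} = {x, h x}"
  let ?G' = "(verts G, edges G - {{u, v}})"
  have h_facts: "h \<in> odd_maps G" "traces h C" "\<And>v. \<exists>n. (h ^^ n) v \<in> verts C"
    using h by (auto simp: cycle_maps_def)
  have step: "(y, h y) \<in> adj ?G'" for y
    using odd_maps_edge[OF h_facts(1), of y] no by auto
  have path: "(y, (h ^^ n) y) \<in> (adj ?G')\<^sup>*" for n y
  proof (induction n)
    case (Suc n)
    then show ?case
      using rtrancl_into_rtrancl[OF Suc step] by simp
  qed simp
  obtain i j where ij: "(h ^^ i) u \<in> verts C" "(h ^^ j) v \<in> verts C"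
    using h_facts(3) by blast
  then obtain n where n: "(h ^^ n) ((h ^^ i) u) = (h ^^ j) v"
    using h_facts(2) unfolding traces_def by blast
  have "(u, (h ^^ j) v) \<in> (adj ?G')\<^sup>*"
    using rtrancl_trans[OF path[of u i] path[of "(h ^^ i) u" n]] n by simp
  then have "(u, v) \<in> (adj ?G')\<^sup>*"
    by (rule rtrancl_trans) (rule reachable_sym[OF path])
  then obtain D where "D \<in> cycles G" "{u, v} \<in> edges D"
    by (rule cycle_through_nonbridge[OF G e])
  then have "{u, v} \<in> edges C"
    using unique by simp
  then show False
    using h_facts(2) no by (auto simp: traces_def)
qed

text \<open>All edges of the graph are used by \<^term>\<open>h0\<close>, so where another map \<^term>\<open>h\<close> differs from
\<^term>\<open>h0\<close> it runs against it. It then runs against it along the whole orbit; since the orbit ends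
on the cycle, tracing it back with \<^term>\<open>h0\<close> shows that it started there. Thus \<^term>\<open>h\<close> is
\<^term>\<open>h0\<close> with the cycle reversed.\<close>

lemma card_cycle_maps_unicyclic:
  fixes G :: "'v::finite graph"
  assumes G: "simple_graph G" and unique: "cycles G = {C}"
  shows "card (cycle_maps G C) \<le> 2"
proof (cases "cycle_maps G C = {}")
  case False
  then obtain h0 where h0: "h0 \<in> cycle_maps G C"
    by blast
  have tr0: "traces h0 C"
    using h0 by (simp add: cycle_maps_def)
  then have img0: "h0 ` verts C = verts C"
    by (simp add: traces_def)
  have inj: "inj_on h0 (verts C)"
    using img0 by (intro eq_card_imp_inj_on) simp_all
  have other: "(\<forall>x. x \<notin> verts C \<longrightarrow> h x = h0 x)
      \<and> (\<forall>x\<in>verts C. h x \<in> verts C \<and> h0 (h x) = x)"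
    if h: "h \<in> cycle_maps G C" "h \<noteq> h0" for h
  proof -
    have h_facts: "h \<in> odd_maps G" "traces h C" "\<And>v. \<exists>n. (h ^^ n) v \<in> verts C"
      using h(1) by (auto simp: cycle_maps_def)
    have either: "h0 v = h v \<or> h0 (h v) = v" for v
    proof -
      have "\<exists>x. {v, h v} = {x, h0 x}"
        by (rule unicyclic_edges[OF G unique h0 odd_maps_edge[OF h_facts(1)]])
      then show ?thesis
        by (auto simp: doubleton_eq_iff)
    qed
    have off: "h v = h0 v" if v: "v \<notin> verts C" for v
    proof (rule ccontr)
      assume differ: "h v \<noteq> h0 v"
      have "h ((h ^^ k) v) \<noteq> h0 ((h ^^ k) v) \<and> (h0 ^^ k) ((h ^^ k) v) = v" for k
      proof (induction k)
        case (Suc k)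
        let ?y = "(h ^^ k) v"
        have step: "h0 (h ?y) = ?y"
          using either[of ?y] Suc by metis
        then have "h (h ?y) \<noteq> h0 (h ?y)"
          using odd_map_no_2_cycle[OF G h_facts(1), of ?y] by simp
        moreover have "(h0 ^^ Suc k) (h ?y) = (h0 ^^ k) (h0 (h ?y))"
          by (simp add: funpow_swap1)
        ultimately show ?case
          using Suc step by simp
      qed (simp add: differ)
      moreover obtain k where "(h ^^ k) v \<in> verts C"
        using h_facts(3) by blast
      ultimately have "v \<in> verts C"
        using funpow_in_closed[of h0 "verts C" "(h ^^ k) v" k] img0 by simp
      with v show False ..
    qed
    have "(\<forall>x\<in>verts C. h0 x = h x) \<or> (\<forall>x\<in>verts C. h0 (h x) = x)"
      using either by (intro forward_or_backward[OF h_facts(2)])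
    moreover have "\<not> (\<forall>x\<in>verts C. h0 x = h x)"
      using off h(2) by (metis ext)
    moreover have "h x \<in> verts C" if "x \<in> verts C" for x
      using h_facts(2) that by (auto simp: traces_def)
    ultimately show ?thesis
      using off by blast
  qed
  have "h = h'" if h: "h \<in> cycle_maps G C - {h0}" and h': "h' \<in> cycle_maps G C - {h0}" for h h'
  proof
    fix x
    show "h x = h' x"
    proof (cases "x \<in> verts C")
      case True
      then show ?thesis
        using other[of h] other[of h'] h h' inj_onD[OF inj, of "h x" "h' x"] by auto
    next
      case False
      then show ?thesis
        using other[of h] other[of h'] h h' by auto
    qed
  qed
  then have "card (cycle_maps G C - {h0}) \<le> 1"
    by (simp add: card_le_Suc0_iff_eq)
  then show ?thesis
    using h0 by (simp add: card_Diff_singleton)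
qed simp

lemma oc_bound_connected:
  fixes G :: "'v::finite graph"
  assumes G: "simple_graph G" and V: "verts G = UNIV" and conn: "connected_graph G"
    and ne: "odd_maps G \<noteq> {}"
  shows "4 * oc G \<le> (\<Sum>h\<in>odd_maps G. card (invariant_sets h))"
    and "(\<Sum>h\<in>odd_maps G. card (invariant_sets h)) = 4 * oc G \<longleftrightarrow> odd_unicyclic G"
proof -
  let ?N = "\<Sum>h\<in>odd_maps G. card (invariant_sets h)"
  obtain h0 where h0: "h0 \<in> odd_maps G"
    using ne by blast
  have two: "card (cycle_maps G C) \<ge> 2" if C: "C \<in> odd_cycles G" for C
  proof -
    obtain h h' where hh: "h \<in> cycle_maps G C" "h' \<in> cycle_maps G C"
      "\<And>x. x \<in> verts C \<Longrightarrow> h x \<noteq> h' x"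
      by (rule cycle_maps_two_orientations[OF conn V C h0]) (rule that)
    obtain x where "x \<in> verts C"
      using hh(1) by (auto simp: cycle_maps_def traces_def)
    then have "h \<noteq> h'"
      using hh(3) by blast
    then have "card {h, h'} = 2"
      by simp
    moreover have "card {h, h'} \<le> card (cycle_maps G C)"
      using hh by (intro card_mono) auto
    ultimately show ?thesis
      by simp
  qed
  have "2 * oc G = (\<Sum>C\<in>odd_cycles G. 2)"
    by (simp add: oc_def)
  also have "\<dots> \<le> (\<Sum>C\<in>odd_cycles G. card (cycle_maps G C))"
    by (intro sum_mono two)
  finally show le: "4 * oc G \<le> ?N"
    using sum_card_cycle_maps_le[of G] by linarith
  show "?N = 4 * oc G \<longleftrightarrow> odd_unicyclic G"
  proof
    assume eq: "?N = 4 * oc G"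
    \<comment> \<open>Any starting vertex will do: its orbit ends in an odd cycle.\<close>
    obtain k n where "n > 0" "(h0 ^^ n) ((h0 ^^ k) undefined) = (h0 ^^ k) undefined"
      by (rule periodic_point_in_orbit)
    then have "odd_cycles G \<noteq> {}"
      using odd_map_traces_periodic(2)[OF G h0] by blast
    then obtain C where C: "C \<in> odd_cycles G"
      and shortest: "\<And>D. D \<in> odd_cycles G \<Longrightarrow> card (verts C) \<le> card (verts D)"
      using ex_has_least_nat[of "\<lambda>C. C \<in> odd_cycles G" _ "\<lambda>C. card (verts C)"] by blast
    obtain h h' where hh: "h \<in> cycle_maps G C" "h' \<in> cycle_maps G C"
      "\<And>x. x \<in> verts C \<Longrightarrow> h x \<noteq> h' x"
      by (rule cycle_maps_two_orientations[OF conn V C h0]) (rule that)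
    have small: "\<not> card (cycle_maps G C) \<ge> 3"
    proof
      assume "card (cycle_maps G C) \<ge> 3"
      then have "(\<Sum>C\<in>odd_cycles G. 2) < (\<Sum>C\<in>odd_cycles G. card (cycle_maps G C))"
        using two C by (intro sum_strict_mono_ex1) (auto intro!: bexI[of _ C])
      then have "2 * oc G < (\<Sum>C\<in>odd_cycles G. card (cycle_maps G C))"
        by (simp add: oc_def)
      then show False
        using sum_card_cycle_maps_le[of G] eq by linarith
    qed
    have "\<exists>x. e = {x, h x}" if e: "e \<in> edges G" for e
    proof -
      obtain u v where uv: "e = {u, v}"
        using G e unfolding simple_graph_def by (metis card_2_iff)
      then show ?thesis
        using third_cycle_map[OF G C shortest hh, of u v] small e by metis
    qed
    moreover have "C \<in> cycles G"
      using C by (simp add: odd_cycles_def)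
    ultimately have "cycles G = {C}"
      using unique_cycle_if_no_other_edges[OF _ hh(1)] by blast
    then show "odd_unicyclic G"
      using conn C by (auto simp: odd_unicyclic_def odd_cycles_def)
  next
    assume "odd_unicyclic G"
    then obtain C where C: "cycles G = {C}" "odd (card (edges C))"
      by (auto simp: odd_unicyclic_def)
    then have odd: "odd_cycles G = {C}"
      by (auto simp: odd_cycles_def)
    have wt: "card (invariant_sets h) = 2" if "h \<in> cycle_maps G C" for h
    proof -
      have "verts C \<noteq> {}"
        using that by (simp add: cycle_maps_def traces_def)
      then show ?thesis
        using invariant_sets_cycle_map[OF that] by simp
    qed
    have "?N = 2 * card (cycle_maps G C)"
      using wt by (simp add: odd_maps_unicyclic[OF G C(1)])
    also have "\<dots> \<le> 4"
      using card_cycle_maps_unicyclic[OF G C(1)] by simp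
    also have "4 = 4 * oc G"
      by (simp add: oc_def odd)
    finally show "?N = 4 * oc G"
      using le by simp
  qed
qed

section \<open>Disconnected graphs\<close>

text \<open>In a disconnected graph every odd map has at least four invariant sets, so more odd maps than odd
cycles suffice. Each cycle \<^term>\<open>C\<close> gets a map that equals \<^term>\<open>h0\<close> outside the component of
\<^term>\<open>C\<close> and traces \<^term>\<open>C\<close> in a direction chosen so that the map is not \<^term>\<open>h0\<close>. These maps
are distinct: maps of cycles in one component have different cycles there, and a map belonging to
two components would equal \<^term>\<open>h0\<close> everywhere. With \<^term>\<open>h0\<close> there is one map more than there
are odd cycles.\<close>

lemma oc_bound_disconnected:
  fixes G :: "'v::finite graph"
  assumes V: "verts G = UNIV" and disconn: "\<not> connected_graph G" and h0: "h0 \<in> odd_maps G"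
  shows "4 * oc G < (\<Sum>h\<in>odd_maps G. card (invariant_sets h))"
proof -
  obtain u v where uv: "(u, v) \<notin> (adj G)\<^sup>*"
    using disconn V by (auto simp: connected_graph_def)
  have four: "card (invariant_sets h) \<ge> 4" if "h \<in> odd_maps G" for h
  proof (rule card_invariant_sets_ge_4)
    show "basin G {v} \<noteq> {}" "basin G {v} \<noteq> UNIV"
      using uv by (auto simp: basin_def)
  qed (use odd_map_closed_basin[OF that] in blast)+
  have "\<exists>h. h \<in> odd_maps G - {h0} \<and> traces h C
      \<and> (\<forall>v\<in>basin G (verts C). \<exists>n. (h ^^ n) v \<in> verts C)
      \<and> (\<forall>v. v \<notin> basin G (verts C) \<longrightarrow> h v = h0 v)" if C: "C \<in> odd_cycles G" for C
  proof -
    obtain h h' where hh: "\<And>x. x \<in> verts C \<Longrightarrow> h x \<noteq> h' x"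
      "\<And>k. k \<in> {h, h'} \<Longrightarrow> k \<in> odd_maps G \<and> traces k C
        \<and> (\<forall>v\<in>basin G (verts C). \<exists>n. (k ^^ n) v \<in> verts C)
        \<and> (\<forall>v. v \<notin> basin G (verts C) \<longrightarrow> k v = h0 v)"
      by (rule both_orientations_extend[OF C h0]) (rule that)
    obtain x where "x \<in> verts C"
      using hh(2)[of h] by (auto simp: traces_def)
    then have "h \<noteq> h0 \<or> h' \<noteq> h0"
      using hh(1) by metis
    then show ?thesis
      using hh(2)[of h] hh(2)[of h'] by blast
  qed
  then obtain F where F: "\<And>C. C \<in> odd_cycles G \<Longrightarrow> F C \<in> odd_maps G - {h0} \<and> traces (F C) C
      \<and> (\<forall>v\<in>basin G (verts C). \<exists>n. (F C ^^ n) v \<in> verts C)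
      \<and> (\<forall>v. v \<notin> basin G (verts C) \<longrightarrow> F C v = h0 v)"
    by metis
  have "inj_on F (odd_cycles G)"
  proof (rule inj_onI)
    fix C D assume C: "C \<in> odd_cycles G" and D: "D \<in> odd_cycles G" and eq: "F C = F D"
    have "\<exists>x\<in>verts D. x \<in> basin G (verts C)"
    proof (rule ccontr)
      assume no: "\<not> ?thesis"
      have "v \<notin> basin G (verts C) \<or> v \<notin> basin G (verts D)" for v
      proof (rule ccontr)
        assume "\<not> ?thesis"
        then obtain x y where x: "x \<in> verts C" "(v, x) \<in> (adj G)\<^sup>*"
          and y: "y \<in> verts D" "(v, y) \<in> (adj G)\<^sup>*"
          by (auto simp: basin_def)
        have "(y, x) \<in> (adj G)\<^sup>*"
          by (rule rtrancl_trans[OF reachable_sym[OF y(2)] x(2)])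
        then have "y \<in> basin G (verts C)"
          using x(1) unfolding basin_def by (intro CollectI bexI)
        then show False
          using no y(1) by (meson bexI)
      qed
      then have "F C v = h0 v" for v
        using F[OF C] F[OF D] eq by metis
      then have "F C = h0"
        by (rule ext)
      then show False
        using F[OF C] by blast
    qed
    then obtain x n where "x \<in> verts D" "(F C ^^ n) x \<in> verts C"
      using F[OF C] by blast
    then show "C = D"
      using traces_unique[of "F C" C D x n] F[OF C] F[OF D] eq by simp
  qed
  then have "oc G = card (F ` odd_cycles G)"
    by (simp add: oc_def card_image)
  also have "\<dots> \<le> card (odd_maps G - {h0})"
    using F by (intro card_mono) auto
  also have "\<dots> < card (odd_maps G)"
    using h0 by (intro psubset_card_mono) auto
  finally have "4 * oc G < (\<Sum>h\<in>odd_maps G. 4)"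
    by simp
  also have "\<dots> \<le> (\<Sum>h\<in>odd_maps G. card (invariant_sets h))"
    by (intro sum_mono four)
  finally show ?thesis .
qed

section \<open>Determinant and number of odd cycles\<close>

theorem corollary3p6:
  fixes G :: "'v::finite graph"
  assumes "simple_graph G"
    and "verts G = UNIV"
    and "bipartite G \<or> (\<forall>C. component C G \<longrightarrow> \<not> bipartite C)"
  shows "det (signless_laplacian G) / 4 \<ge> real (oc G) \<and>
    (det (signless_laplacian G) / 4 = real (oc G) \<longleftrightarrow> bipartite G \<or> odd_unicyclic G)"
proof -
  let ?N = "\<Sum>h\<in>odd_maps G. card (invariant_sets h)"
  have det: "det (signless_laplacian G) = real ?N"
    by (rule det_signless_laplacian_eq_sum_invariant_sets[OF assms(1)])
  have "4 * oc G \<le> ?N \<and> (?N = 4 * oc G \<longleftrightarrow> bipartite G \<or> odd_unicyclic G)"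
  proof (cases "bipartite G")
    case True
    then show ?thesis
      by (simp add: oc_def bipartite_no_odd_cycles bipartite_no_odd_maps)
  next
    case False
    have "det (signless_laplacian G) \<noteq> 0"
    proof
      assume "det (signless_laplacian G) = 0"
      then obtain C where "component C G" "bipartite C"
        by (rule singular_imp_bipartite_component[OF assms(1,2)])
      with assms(3) False show False
        by blast
    qed
    then have ne: "odd_maps G \<noteq> {}"
      using det by auto
    show ?thesis
    proof (cases "connected_graph G")
      case True
      show ?thesis
        using oc_bound_connected[OF assms(1,2) True ne] False by blast
    next
      case disconn: False
      then have "\<not> odd_unicyclic G"
        by (simp add: odd_unicyclic_def)
      moreover obtain h0 where "h0 \<in> odd_maps G"
        using ne by blast
      ultimately show ?thesis
        using oc_bound_disconnected[OF assms(2) disconn] False by fastforce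
    qed
  qed
  moreover have "real (oc G) \<le> real ?N / 4 \<longleftrightarrow> 4 * oc G \<le> ?N"
    "real ?N / 4 = real (oc G) \<longleftrightarrow> ?N = 4 * oc G"
    by linarith+
  ultimately show ?thesis
    unfolding det by blast
qed

end
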